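(* Let $n\in\mathbb{N}$ and $d=2n$. A subset $S\subseteq[2n+1]$ is a Dehn--Sommerville basis of dimension $2n$ if and only if $S$ is the set of upsteps of some Dyck path of length $2(n+1)$.
   Context: For a simplicial $d$-polytope $P$ (a polytope all of whose facets are simplices), its $f$-vector is $f(P)=(f_{-1},f_0,\dots,f_{d-1})$, where $f_i$ is the number of $i$-dimensional faces and $f_{-1}=1$. Index the $d+1$ entries of the $f$-vector by positions $1,\dots,d+1$, position $j$ holding $f_{j-2}$. A Dehn--Sommerville basis of dimension $d$ is a minimal subset $S\subseteq[d+1]$ such that the entries of the $f$-vector in the positions of $S$ determine the entire $f$-vector, for any simplicial $d$-polytope. A Dyck path of length $2m$ is a lattice path from $(0,0)$ to $(2m,0)$ consisting of $2m$ steps, each an upstep $(1,1)$ or a downstep $(1,-1)$, never going below the $x$-axis; its steps are numbered $1,\dots,2m$, and its upstep set is the set of numbers of its upsteps (a subset of $[2m]$; note step $2m$ is never an upstep).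
   Formalization: "Determine" is read as: every entry is a homogeneous linear combination, with coefficients uniform over all simplicial d-polytopes, of the entries in S, with f_{-1} an ordinary entry. Read literally, f_{-1}=1 is free, so no minimal S contains position 1 and the claim fails (d=2: {2},{3}). *)

theory Defs
  imports "HOL-Analysis.Analysis"
begin

text \<open>A \<open>d\<close>-polytope may live in a Euclidean space of dimension larger than \<open>d\<close>.\<close>

definition simplicial_polytope :: "nat \<Rightarrow> 'a::euclidean_space set \<Rightarrow> bool" where
  "simplicial_polytope d P \<longleftrightarrow>
     polytope P \<and> aff_dim P = int d \<and> (\<forall>F. F facet_of P \<longrightarrow> (int d - 1) simplex F)"

text \<open>Entry \<open>f\<^sub>i\<close> of the \<open>f\<close>-vector. The empty set is a face, of dimension \<open>-1\<close>, so that
  \<open>f\<^sub>-\<^sub>1 = 1\<close>.\<close>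

definition f_num :: "'a::euclidean_space set \<Rightarrow> int \<Rightarrow> nat" where
  "f_num P i = card {F. F face_of P \<and> aff_dim F = i}"

definition f_pos :: "'a::euclidean_space set \<Rightarrow> nat \<Rightarrow> nat" where
  "f_pos P j = f_num P (int j - 2)"

text \<open>``Determine'' is meant in the sense of linear algebra, as are the Dehn--Sommerville
  relations: every entry is a linear combination of the entries in the positions of \<open>S\<close>, with
  coefficients that depend only on the dimension, not on the polytope. The combinations are
  homogeneous, with \<open>f\<^sub>-\<^sub>1\<close> an entry like any other. If the constant value
  \<open>f\<^sub>-\<^sub>1 = 1\<close> could be used without being paid for, position \<open>1\<close> would belong to no minimal
  \<open>S\<close>, whereas the first step of a Dyck path is always an upstep. The type argument is the
  ambient space of the polytopes.\<close>

definition determines_f_vector :: "'a::euclidean_space itself \<Rightarrow> nat \<Rightarrow> nat set \<Rightarrow> bool" where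
  "determines_f_vector _ d S \<longleftrightarrow>
     (\<exists>c :: nat \<Rightarrow> nat \<Rightarrow> real. \<forall>P :: 'a set. simplicial_polytope d P \<longrightarrow>
        (\<forall>j\<in>{1..d + 1}. real (f_pos P j) = (\<Sum>i\<in>S. c j i * real (f_pos P i))))"

definition dehn_sommerville_basis :: "'a::euclidean_space itself \<Rightarrow> nat \<Rightarrow> nat set \<Rightarrow> bool" where
  "dehn_sommerville_basis T d S \<longleftrightarrow>
     S \<subseteq> {1..d + 1} \<and> determines_f_vector T d S \<and> (\<forall>S'. S' \<subset> S \<longrightarrow> \<not> determines_f_vector T d S')"

text \<open>A lattice path is given by the list of the vertical components of its steps.\<close>

definition dyck_path :: "nat \<Rightarrow> int list \<Rightarrow> bool" where
  "dyck_path m w \<longleftrightarrow>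
     length w = 2 * m \<and> set w \<subseteq> {1, -1} \<and>
     (\<forall>k\<le>2 * m. 0 \<le> sum_list (take k w)) \<and> sum_list w = 0"

definition upsteps :: "int list \<Rightarrow> nat set" where
  "upsteps w = {i. 1 \<le> i \<and> i \<le> length w \<and> w ! (i - 1) = 1}"

end

theory Submission
  imports Defs "Jordan_Normal_Form.Determinant"
begin

text \<open>
  Let \<open>F(t) = \<Sum> f\<^sub>i\<^sub>-\<^sub>1 t\<^sup>i\<close>. Pushing a point of the cone over a face in a
  generic direction assigns to every face one facet, and the faces assigned to a facet form a Boolean
  interval; comparing the direction with its opposite gives \<open>F(-1-t) = (-1)\<^sup>d F(t)\<close>. For
  \<open>d = 2n\<close> this says that \<open>F\<close> is a polynomial of degree at most \<open>n\<close> in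
  \<open>t + t\<^sup>2\<close>. Cyclic polytopes have \<open>f\<^sub>i\<^sub>-\<^sub>1 = (N choose i)\<close> for
  \<open>i \<le> n\<close>, so there are no further linear relations. Hence the Dehn--Sommerville bases are
  the sets of columns forming a basis in the matrix of coefficients of the powers of
  \<open>t + t\<^sup>2\<close>. Columns \<open>e\<^sub>0 < \<dots> < e\<^sub>n\<close> form a basis iff
  \<open>e\<^sub>k \<le> 2k\<close> for all \<open>k\<close>, since under this condition Pascal's rule exhibits
  the minor as a positive number; and this is the ballot condition for the upsteps of a Dyck path.
\<close>

section \<open>Complete simplicial fans and the Dehn--Sommerville relations\<close>

text \<open>Linear determination is a statement about the span of all f-vectors, so two inclusions
  are needed. The symmetry places every f-vector in the row space of the coefficient matrix.
  Conversely, a further relation valid for all polytopes has to be excluded: applied to cyclic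
  polytopes with arbitrarily many vertices, it becomes a polynomial identity in the number
  \<open>N\<close> of vertices. Hence a set of positions determines the f-vector exactly when its
  columns span the column space. The bound \<open>2 * k\<close> comes from degrees:
  \<open>(t + t^2)^j\<close> with \<open>j \<le> k\<close> has degree at most \<open>2 * k\<close>,
  so a column with a larger exponent vanishes in rows \<open>0\<close> to \<open>k\<close>. An
  independent family contains at most \<open>n - k\<close> such columns, which forces the
  inequality; the minors serve the other direction. Minors are treated with general upper arguments
  because Pascal's rule lowers all of them at once and so leaves the original shape of the
  matrix.\<close>

text \<open>Along a line \<open>v + t w\<close>, a functional that is nonzero at some point of the
  line vanishes for at most one \<open>t\<close>, so finitely many functionals exclude finitely many
  \<open>t\<close>. Linearity is asked only on \<open>U\<close> because coordinates are linear only
  on the span of the generators.\<close>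

lemma exists_generic_vector:
  fixes g :: "'i \<Rightarrow> 'a::real_vector \<Rightarrow> real"
  assumes "finite I" "subspace U"
    and add: "\<And>i x y. i \<in> I \<Longrightarrow> x \<in> U \<Longrightarrow> y \<in> U \<Longrightarrow> g i (x + y) = g i x + g i y"
    and scale: "\<And>i x r. i \<in> I \<Longrightarrow> x \<in> U \<Longrightarrow> g i (r *\<^sub>R x) = r * g i x"
    and nz: "\<And>i. i \<in> I \<Longrightarrow> \<exists>w\<in>U. g i w \<noteq> 0"
  shows "\<exists>v\<in>U. \<forall>i\<in>I. g i v \<noteq> 0"
  using \<open>finite I\<close> add scale nz
proof (induction I rule: finite_induct)
  case empty
  then show ?case using subspace_0[OF \<open>subspace U\<close>] by auto
next
  case (insert i I)
  obtain v where v: "v \<in> U" "\<forall>j\<in>I. g j v \<noteq> 0"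
    using insert.IH insert.prems by (metis insertCI)
  obtain w where w: "w \<in> U" "g i w \<noteq> 0"
    using insert.prems(3)[of i] by auto
  \<comment> \<open>These are the zeros along the line. If \<open>g j w = 0\<close>, the quotient is
    the default \<open>0\<close>; then \<open>j\<close> is not the new index and the value is
    \<open>g j v\<close>, nonzero by induction.\<close>
  let ?bad = "(\<lambda>j. - g j v / g j w) ` insert i I"
  obtain t where t: "t \<notin> ?bad" "t \<noteq> 0"
    using ex_new_if_finite[of "insert 0 ?bad"] insert.hyps infinite_UNIV_char_0 by auto
  have "g j (v + t *\<^sub>R w) \<noteq> 0" if j: "j \<in> insert i I" for j
  proof -
    have eq: "g j (v + t *\<^sub>R w) = g j v + t * g j w"
      using insert.prems(1)[OF j v(1) subspace_scale[OF \<open>subspace U\<close> w(1)]] insert.prems(2)[OF j w(1)]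
      by simp
    show ?thesis
    proof (cases "g j w = 0")
      case True
      with j w v show ?thesis unfolding eq by auto
    next
      case False
      have "t \<noteq> - g j v / g j w" using t(1) j by blast
      with False show ?thesis unfolding eq by (simp add: field_simps) 
    qed
  qed
  moreover have "v + t *\<^sub>R w \<in> U"
    using v w \<open>subspace U\<close> by (simp add: subspace_add subspace_scale)
  ultimately show ?case by blast
qed

lemma sum_pow_card_interval:
  fixes t :: real
  assumes "finite V" "R \<subseteq> V"
  shows "(\<Sum>\<tau> | R \<subseteq> \<tau> \<and> \<tau> \<subseteq> V. t ^ card \<tau>) = t ^ card R * (1 + t) ^ card (V - R)"
proof -
  have fin: "finite R" using assms finite_subset by blast
  have "(\<Sum>\<tau> | R \<subseteq> \<tau> \<and> \<tau> \<subseteq> V. t ^ card \<tau>) = (\<Sum>\<rho>\<in>Pow (V - R). t ^ card (R \<union> \<rho>))"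
    by (rule sum.reindex_bij_witness[where i = "\<lambda>\<rho>. R \<union> \<rho>" and j = "\<lambda>\<tau>. \<tau> - R"])
       (use assms in \<open>auto simp: Un_absorb1\<close>)
  also have "\<dots> = (\<Sum>\<rho>\<in>Pow (V - R). t ^ card R * t ^ card \<rho>)"
  proof (rule sum.cong[OF refl])
    fix \<rho> assume "\<rho> \<in> Pow (V - R)"
    then have "card (R \<union> \<rho>) = card R + card \<rho>"
      using assms fin by (intro card_Un_disjoint) (auto intro: finite_subset)
    then show "t ^ card (R \<union> \<rho>) = t ^ card R * t ^ card \<rho>" by (simp add: power_add)
  qed
  also have "\<dots> = t ^ card R * (\<Sum>\<rho>\<in>Pow (V - R). (\<Prod>i\<in>\<rho>. t) * (\<Prod>i\<in>V - R - \<rho>. 1))"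
    by (simp add: sum_distrib_left)
  also have "\<dots> = t ^ card R * (\<Prod>i\<in>V - R. t + 1)"
    using prod_add[of "V - R" "\<lambda>_. t" "\<lambda>_. 1"] assms by simp
  finally show ?thesis by (simp add: add.commute)
qed

text \<open>Cones are given by their generators \<open>V\<close>, and membership in a cone by nonnegative
  coordinates. The last assumption replaces the condition that cones meet in common faces.\<close>

locale complete_simplicial_fan =
  fixes U :: "'a::real_normed_vector set" and \<V> :: "'a set set" and d :: nat
  assumes finite_cones: "finite \<V>"
    and finite_gens: "V \<in> \<V> \<Longrightarrow> finite V"
    and card_gens: "V \<in> \<V> \<Longrightarrow> card V = d"
    and indep: "V \<in> \<V> \<Longrightarrow> independent V"
    and span_gens: "V \<in> \<V> \<Longrightarrow> span V = U"
    and subspace_U: "subspace U"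
    and complete: "y \<in> U \<Longrightarrow> \<exists>V\<in>\<V>. \<forall>u\<in>V. 0 \<le> representation V y u"
    and support_unique:
      "\<lbrakk>V \<in> \<V>; W \<in> \<V>; y \<in> U; \<forall>u\<in>V. 0 \<le> representation V y u; \<forall>u\<in>W. 0 \<le> representation W y u\<rbrakk>
       \<Longrightarrow> {u \<in> V. representation V y u \<noteq> 0} = {u \<in> W. representation W y u \<noteq> 0}"
begin

text \<open>A cone of any dimension is encoded by its generators. The empty set is the origin and
  accounts for the entry \<open>f_{-1}\<close>.\<close>

definition cones :: "'a set set" where
  "cones = {\<tau>. \<exists>V\<in>\<V>. \<tau> \<subseteq> V}"

lemma finite_cones_set: "finite cones"
proof -
  have "cones = (\<Union>V\<in>\<V>. Pow V)" by (auto simp: cones_def)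
  then show ?thesis using finite_cones finite_gens by simp
qed

lemma gens_in_U: "V \<in> \<V> \<Longrightarrow> V \<subseteq> U"
  using span_gens span_superset by blast

lemma rep_line:
  assumes "V \<in> \<V>" "x \<in> U" "v \<in> U"
  shows "representation V (x + t *\<^sub>R v) u = representation V x u + t * representation V v u"
  using assms indep span_gens subspace_scale[OF subspace_U]
  by (simp add: representation_add representation_scale)

text \<open>The sum of the generators is a relatively interior point of the cone, and its support
  recovers \<open>\<tau>\<close>.\<close>

lemma rep_sum_gens:
  assumes "V \<in> \<V>" "\<tau> \<subseteq> V"
  shows "representation V (\<Sum>u\<in>\<tau>. u) w = (if w \<in> \<tau> then 1 else 0)"
proof -
  have fin: "finite \<tau>" using assms finite_gens finite_subset by blast
  have "representation V (\<Sum>u\<in>\<tau>. u) w = (\<Sum>u\<in>\<tau>. representation V u w)"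
    using assms indep gens_in_U span_gens by (subst representation_sum) auto
  also have "\<dots> = (\<Sum>u\<in>\<tau>. if w = u then 1 else 0)"
    using assms indep by (intro sum.cong refl) (auto simp: representation_basis)
  finally show ?thesis using fin by simp
qed

text \<open>Such a direction avoids every hyperplane spanned by a maximal cone with one generator
  removed.\<close>

definition generic :: "'a \<Rightarrow> bool" where
  "generic v \<longleftrightarrow> v \<in> U \<and> (\<forall>V\<in>\<V>. \<forall>u\<in>V. representation V v u \<noteq> 0)"

lemma exists_generic: "\<exists>v. generic v"
proof -
  have "\<exists>v\<in>U. \<forall>i\<in>Sigma \<V> (\<lambda>V. V). (case i of (V, u) \<Rightarrow> \<lambda>x. representation V x u) v \<noteq> 0"
  proof (rule exists_generic_vector)
    show "finite (Sigma \<V> (\<lambda>V. V))" using finite_cones finite_gens by simp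
  next
    fix i :: "'a set \<times> 'a" and x y assume "i \<in> Sigma \<V> (\<lambda>V. V)" "x \<in> U" "y \<in> U"
    then show "(case i of (V, u) \<Rightarrow> \<lambda>x. representation V x u) (x + y) =
        (case i of (V, u) \<Rightarrow> \<lambda>x. representation V x u) x + (case i of (V, u) \<Rightarrow> \<lambda>x. representation V x u) y"
      using indep span_gens by (auto simp: representation_add)
  next
    fix i :: "'a set \<times> 'a" and x r assume "i \<in> Sigma \<V> (\<lambda>V. V)" "x \<in> U"
    then show "(case i of (V, u) \<Rightarrow> \<lambda>x. representation V x u) (r *\<^sub>R x) =
        r * (case i of (V, u) \<Rightarrow> \<lambda>x. representation V x u) x"
      using indep span_gens by (auto simp: representation_scale)
  next
    fix i :: "'a set \<times> 'a" assume "i \<in> Sigma \<V> (\<lambda>V. V)"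
    then show "\<exists>w\<in>U. (case i of (V, u) \<Rightarrow> \<lambda>x. representation V x u) w \<noteq> 0"
      using indep gens_in_U by (force simp: representation_basis)
  qed (fact subspace_U)
  then show ?thesis by (auto simp: generic_def)
qed

lemma generic_uminus: "generic v \<Longrightarrow> generic (- v)"
  using indep span_gens subspace_neg[OF subspace_U] by (auto simp: generic_def representation_neg)

text \<open>A cone that contains points approaching \<open>x\<close> along \<open>v\<close> contains
  \<open>x\<close> in the limit. Equality of supports then makes \<open>\<tau>\<close> a face of it,
  and outside \<open>\<tau>\<close> the coordinates of \<open>x\<close> vanish, so the signs near
  \<open>x\<close> are those of \<open>v\<close>.\<close>

lemma cone_entered_exists:
  assumes v: "generic v" and \<tau>: "\<tau> \<in> cones"
  shows "\<exists>V\<in>\<V>. \<tau> \<subseteq> V \<and> (\<forall>u\<in>V - \<tau>. 0 < representation V v u)"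
proof -
  obtain V0 where V0: "V0 \<in> \<V>" "\<tau> \<subseteq> V0" using \<tau> by (auto simp: cones_def)
  define x where "x = (\<Sum>u\<in>\<tau>. u)"
  have vU: "v \<in> U" using v by (simp add: generic_def)
  have xU: "x \<in> U" unfolding x_def
    using V0 gens_in_U subspace_U by (intro subspace_sum) auto
  define y where "y m = x + (1 / real (Suc m)) *\<^sub>R v" for m
  have yU: "y m \<in> U" for m
    unfolding y_def using xU vU subspace_U by (intro subspace_add subspace_scale)
  have "\<forall>m. \<exists>V. V \<in> \<V> \<and> (\<forall>u\<in>V. 0 \<le> representation V (y m) u)"
    using complete[OF yU] by blast
  then obtain W where W: "\<And>m. W m \<in> \<V>" "\<And>m u. u \<in> W m \<Longrightarrow> 0 \<le> representation (W m) (y m) u"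
    by metis
  \<comment> \<open>Infinitely many points lie in finitely many cones, so one cone contains
    \<open>y m\<close> for arbitrarily large \<open>m\<close>.\<close>
  have "finite (range W)" using W(1) finite_cones by (meson finite_subset image_subsetI)
  then obtain m0 where inf: "infinite {m \<in> UNIV. W m = W m0}"
    using pigeonhole_infinite[of "UNIV::nat set" W] by auto
  define V where "V = W m0"
  have V: "V \<in> \<V>" using W(1) by (simp add: V_def)
  have frequently: "\<exists>m\<ge>k. \<forall>u\<in>V. 0 \<le> representation V x u + (1 / real (Suc m)) * representation V v u" for k
  proof -
    obtain m where "m \<ge> k" "W m = V"
      using inf unfolding V_def infinite_nat_iff_unbounded_le by blast
    then show ?thesis using W(2)[of _ m] rep_line[OF V xU vU] unfolding y_def by metis
  qed
  have x_nonneg: "0 \<le> representation V x u" if u: "u \<in> V" for u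
  proof (rule ccontr)
    assume neg: "\<not> 0 \<le> representation V x u"
    have "(\<lambda>m. representation V x u + (1 / real (Suc m)) * representation V v u)
        \<longlonglongrightarrow> representation V x u + 0 * representation V v u"
      by (intro tendsto_intros LIMSEQ_Suc lim_1_over_n)
    then have "eventually (\<lambda>m. representation V x u + (1 / real (Suc m)) * representation V v u < 0) sequentially"
      using neg by (intro order_tendstoD) auto
    then obtain k where "\<And>m. m \<ge> k \<Longrightarrow> representation V x u + (1 / real (Suc m)) * representation V v u < 0"
      unfolding eventually_sequentially by blast
    then show False using frequently[of k] u by force
  qed
  have "{u \<in> V0. representation V0 x u \<noteq> 0} = {u \<in> V. representation V x u \<noteq> 0}"
    by (rule support_unique) (use V0 V xU x_nonneg rep_sum_gens[OF V0] in \<open>auto simp: x_def\<close>)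
  moreover have "{u \<in> V0. representation V0 x u \<noteq> 0} = \<tau>"
    using V0 rep_sum_gens[OF V0] by (auto simp: x_def)
  ultimately have supp: "\<tau> = {u \<in> V. representation V x u \<noteq> 0}" by simp
  have "0 < representation V v u" if "u \<in> V - \<tau>" for u
  proof -
    have "representation V x u = 0" using that supp by blast
    moreover obtain m where "\<forall>u\<in>V. 0 \<le> representation V x u + (1 / real (Suc m)) * representation V v u"
      using frequently[of 0] by blast
    then have "0 \<le> representation V x u + (1 / real (Suc m)) * representation V v u"
      using that by blast
    ultimately have "0 \<le> (1 / real (Suc m)) * representation V v u" by simp
    then have "0 \<le> representation V v u" by (simp add: zero_le_divide_iff zero_le_mult_iff)
    moreover have "representation V v u \<noteq> 0" using v V that by (auto simp: generic_def)
    ultimately show ?thesis by simp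
  qed
  then show ?thesis using V supp by blast
qed

text \<open>For small positive \<open>t\<close>, the point \<open>x + t v\<close> has only positive
  coordinates in both cones, so its supports there are all of \<open>V\<close> and all of
  \<open>W\<close>.\<close>

lemma cone_entered_unique:
  assumes v: "generic v"
    and V: "V \<in> \<V>" "\<tau> \<subseteq> V" "\<forall>u\<in>V - \<tau>. 0 < representation V v u"
    and W: "W \<in> \<V>" "\<tau> \<subseteq> W" "\<forall>u\<in>W - \<tau>. 0 < representation W v u"
  shows "V = W"
proof -
  define x where "x = (\<Sum>u\<in>\<tau>. u)"
  have vU: "v \<in> U" using v by (simp add: generic_def)
  have xU: "x \<in> U" unfolding x_def
    using V gens_in_U subspace_U by (intro subspace_sum) auto
  have ev: "\<forall>\<^sub>F t in at_right 0. \<forall>u\<in>X. 0 < representation X (x + t *\<^sub>R v) u"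
    if X: "X \<in> \<V>" "\<tau> \<subseteq> X" "\<forall>u\<in>X - \<tau>. 0 < representation X v u" for X
  proof (rule eventually_ball_finite)
    show "finite X" using finite_gens X by simp
    show "\<forall>u\<in>X. \<forall>\<^sub>F t in at_right 0. 0 < representation X (x + t *\<^sub>R v) u"
    proof
      fix u assume u: "u \<in> X"
      show "\<forall>\<^sub>F t in at_right 0. 0 < representation X (x + t *\<^sub>R v) u"
      proof (cases "u \<in> \<tau>")
        case True
        have "((\<lambda>t. representation X x u + t * representation X v u) \<longlongrightarrow>
            representation X x u + 0 * representation X v u) (at_right 0)"
          by (intro tendsto_intros)
        moreover have "representation X x u = 1"
          unfolding x_def using True rep_sum_gens[OF X(1,2)] by simp
        ultimately have "\<forall>\<^sub>F t in at_right 0. 0 < representation X x u + t * representation X v u"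
          by (intro order_tendstoD) auto
        then show ?thesis by (simp add: rep_line[OF X(1) xU vU])
      next
        case False
        then have "representation X x u = 0" "0 < representation X v u"
          unfolding x_def using u X rep_sum_gens[OF X(1,2)] by auto
        then show ?thesis
          using eventually_at_right_less[of "0::real"]
          by (auto simp: rep_line[OF X(1) xU vU] elim: eventually_mono)
      qed
    qed
  qed
  have "\<forall>\<^sub>F t in at_right (0::real). (\<forall>u\<in>V. 0 < representation V (x + t *\<^sub>R v) u) \<and>
      (\<forall>u\<in>W. 0 < representation W (x + t *\<^sub>R v) u)"
    using ev[OF V] ev[OF W] by (rule eventually_conj)
  then obtain t where t: "\<forall>u\<in>V. 0 < representation V (x + t *\<^sub>R v) u"
      "\<forall>u\<in>W. 0 < representation W (x + t *\<^sub>R v) u"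
    using eventually_happens'[OF trivial_limit_at_right_real] by blast
  have "{u \<in> V. representation V (x + t *\<^sub>R v) u \<noteq> 0} = {u \<in> W. representation W (x + t *\<^sub>R v) u \<noteq> 0}"
    by (rule support_unique)
       (use t V W xU vU subspace_U in \<open>auto intro!: subspace_add subspace_scale less_imp_le\<close>)
  then show ?thesis using t by force
qed

text \<open>The analogue of the restriction of a facet in a shelling: the number of \<open>V\<close>
  whose restriction has \<open>i\<close> elements is the entry \<open>h_i\<close> of the
  h-vector.\<close>

definition restriction :: "'a \<Rightarrow> 'a set \<Rightarrow> 'a set" where
  "restriction v V = {u \<in> V. representation V v u < 0}"

text \<open>The faces \<open>\<tau>\<close> from which the direction \<open>v\<close> enters the cone \<open>V\<close>
  are exactly those between \<open>restriction v V\<close> and \<open>V\<close>.\<close>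

lemma f_polynomial_eq:
  fixes t :: real
  assumes v: "generic v"
  shows "(\<Sum>\<tau>\<in>cones. t ^ card \<tau>) =
    (\<Sum>V\<in>\<V>. t ^ card (restriction v V) * (1 + t) ^ (d - card (restriction v V)))"
proof -
  let ?I = "\<lambda>V. {\<tau>. restriction v V \<subseteq> \<tau> \<and> \<tau> \<subseteq> V}"
  have I: "\<tau> \<in> ?I V \<longleftrightarrow> \<tau> \<subseteq> V \<and> (\<forall>u\<in>V - \<tau>. 0 < representation V v u)" if "V \<in> \<V>" for V \<tau>
  proof -
    have nz: "representation V v u \<noteq> 0" if "u \<in> V" for u
      using v \<open>V \<in> \<V>\<close> that unfolding generic_def by blast
    have "representation V v u < 0 \<longleftrightarrow> \<not> 0 < representation V v u" if "u \<in> V" for u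
      using nz[OF that] by linarith
    then show ?thesis unfolding restriction_def by blast
  qed
  have "cones = (\<Union>V\<in>\<V>. ?I V)"
  proof
    show "cones \<subseteq> (\<Union>V\<in>\<V>. ?I V)"
    proof
      fix \<tau> assume "\<tau> \<in> cones"
      then obtain V where V: "V \<in> \<V>" "\<tau> \<subseteq> V \<and> (\<forall>u\<in>V - \<tau>. 0 < representation V v u)"
        using cone_entered_exists[OF v] by blast
      show "\<tau> \<in> (\<Union>V\<in>\<V>. ?I V)" 
        by (rule UN_I[OF V(1)]) (rule I[OF V(1), THEN iffD2, OF V(2)])
    qed
    show "(\<Union>V\<in>\<V>. ?I V) \<subseteq> cones" by (auto simp: cones_def)
  qed
  then have "(\<Sum>\<tau>\<in>cones. t ^ card \<tau>) = (\<Sum>\<tau>\<in>(\<Union>V\<in>\<V>. ?I V). t ^ card \<tau>)" by simp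
  also have "\<dots> = (\<Sum>V\<in>\<V>. \<Sum>\<tau>\<in>?I V. t ^ card \<tau>)"
  proof (rule sum.UNION_disjoint)
    show "\<forall>V\<in>\<V>. finite (?I V)" using finite_gens by (auto intro: finite_subset[of _ "Pow _"])
    show "\<forall>V\<in>\<V>. \<forall>W\<in>\<V>. V \<noteq> W \<longrightarrow> ?I V \<inter> ?I W = {}"
    proof (intro ballI impI)
      fix V W assume VW: "V \<in> \<V>" "W \<in> \<V>" "V \<noteq> W"
      then have "\<not> (\<tau> \<in> ?I V \<and> \<tau> \<in> ?I W)" for \<tau>
        using cone_entered_unique[OF v VW(1) _ _ VW(2), of \<tau>] unfolding I[OF VW(1)] I[OF VW(2)] by blast
      then show "?I V \<inter> ?I W = {}" by blast
    qed
  qed (fact finite_cones)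
  also have "\<dots> = (\<Sum>V\<in>\<V>. t ^ card (restriction v V) * (1 + t) ^ (d - card (restriction v V)))"
  proof (rule sum.cong[OF refl])
    fix V assume V: "V \<in> \<V>"
    have R: "restriction v V \<subseteq> V" by (auto simp: restriction_def)
    have "card (V - restriction v V) = d - card (restriction v V)"
      using card_Diff_subset[OF finite_subset[OF R] R] finite_gens card_gens V by simp
    then show "(\<Sum>\<tau>\<in>?I V. t ^ card \<tau>) = t ^ card (restriction v V) * (1 + t) ^ (d - card (restriction v V))"
      using sum_pow_card_interval[OF finite_gens[OF V] R] by simp
  qed
  finally show ?thesis .
qed

lemma card_restriction_uminus:
  assumes "generic v" "V \<in> \<V>"
  shows "card (restriction v V) \<le> d" "card (restriction (- v) V) = d - card (restriction v V)"
proof -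
  have R: "restriction v V \<subseteq> V" by (auto simp: restriction_def)
  have "restriction (- v) V = V - restriction v V"
    using assms indep[of V] span_gens[of V] by (force simp: restriction_def generic_def representation_neg neq_iff)
  then show "card (restriction (- v) V) = d - card (restriction v V)"
    using card_Diff_subset[OF finite_subset[OF R] R] finite_gens card_gens assms by simp
  show "card (restriction v V) \<le> d" using card_mono[OF _ R] finite_gens card_gens assms by simp
qed

text \<open>Substituting \<open>- 1 - t\<close> exchanges the factors \<open>t\<close> and
  \<open>1 + t\<close> up to sign. Replacing \<open>v\<close> by \<open>- v\<close> complements
  every restriction and so exchanges the exponents back, while the sum over the cones does not
  depend on the direction.\<close>

lemma f_polynomial_symmetric:
  "(\<Sum>\<tau>\<in>cones. (- 1 - t) ^ card \<tau>) = (- 1) ^ d * (\<Sum>\<tau>\<in>cones. t ^ card \<tau>)" for t :: real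
proof -
  obtain v where v: "generic v" using exists_generic by blast
  have "(\<Sum>\<tau>\<in>cones. (- 1 - t) ^ card \<tau>) =
      (\<Sum>V\<in>\<V>. (- 1 - t) ^ card (restriction v V) * (- t) ^ (d - card (restriction v V)))"
    unfolding f_polynomial_eq[OF v] by (intro sum.cong refl) simp
  also have "\<dots> = (\<Sum>V\<in>\<V>. (- 1) ^ d * (t ^ card (restriction (- v) V) * (1 + t) ^ (d - card (restriction (- v) V))))"
  proof (rule sum.cong[OF refl])
    fix V assume V: "V \<in> \<V>"
    define r where "r = card (restriction v V)"
    have r: "r \<le> d" "card (restriction (- v) V) = d - r"
      using card_restriction_uminus[OF v V] by (auto simp: r_def)
    have "(- 1 - t) ^ r = (- 1) ^ r * (1 + t) ^ r"
      using power_minus[of "1 + t" r] by simp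
    moreover have "(- t) ^ (d - r) = (- 1) ^ (d - r) * t ^ (d - r)"
      by (rule power_minus)
    moreover have "(- 1 :: real) ^ d = (- 1) ^ r * (- 1) ^ (d - r)"
      using r by (metis le_add_diff_inverse power_add)
    moreover have "d - (d - r) = r" using r by simp
    ultimately show "(- 1 - t) ^ card (restriction v V) * (- t) ^ (d - card (restriction v V)) =
        (- 1) ^ d * (t ^ card (restriction (- v) V) * (1 + t) ^ (d - card (restriction (- v) V)))"
      unfolding r(2) r_def[symmetric] by (simp only: mult_ac)
  qed
  also have "\<dots> = (- 1) ^ d * (\<Sum>\<tau>\<in>cones. t ^ card \<tau>)"
    unfolding f_polynomial_eq[OF generic_uminus[OF v]] by (simp add: sum_distrib_left)
  finally show ?thesis .
qed

end

section \<open>The face fan of a simplicial polytope\<close>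

text \<open>The set is recovered from its hull as the set of extreme points. This lets simplices be
  replaced by their vertex sets throughout.\<close>

lemma convex_hull_affine_independent_inj:
  fixes S :: "'a::euclidean_space set"
  assumes "\<not> affine_dependent S" "\<not> affine_dependent T" "convex hull S = convex hull T"
  shows "S = T"
proof -
  have "X = {x. x extreme_point_of (convex hull X)}" if "\<not> affine_dependent X" for X :: "'a set"
    using extreme_point_of_convex_hull_affine_independent[OF that] by simp
  then show ?thesis using assms by metis
qed

text \<open>Serves to move a relatively interior point to the origin, from where the facets span
  cones.\<close>

lemma f_num_translation:
  fixes P :: "'a::euclidean_space set"
  shows "f_num ((+) a ` P) i = f_num P i"
proof -
  have "{F. F face_of (+) a ` P \<and> aff_dim F = i} = (`) ((+) a) ` {F. F face_of P \<and> aff_dim F = i}"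
  proof (intro equalityI subsetI)
    fix F assume F: "F \<in> {F. F face_of (+) a ` P \<and> aff_dim F = i}"
    define G where "G = (+) (- a) ` F"
    have FG: "F = (+) a ` G" by (simp add: G_def image_image)
    with F have "G \<in> {F. F face_of P \<and> aff_dim F = i}" by (simp add: aff_dim_translation_eq)
    with FG show "F \<in> (`) ((+) a) ` {F. F face_of P \<and> aff_dim F = i}" by blast
  qed (auto simp: aff_dim_translation_eq)
  moreover have "inj_on ((`) ((+) a)) A" for A :: "'a set set"
    by (rule inj_onI) (simp add: inj_image_eq_iff)
  ultimately show ?thesis by (simp add: f_num_def card_image)
qed

lemma simplex_translation:
  fixes P :: "'a::euclidean_space set"
  assumes "k simplex P"
  shows "k simplex ((+) a ` P)"
proof -
  obtain C where C: "\<not> affine_dependent C" "int (card C) = k + 1" "P = convex hull C"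
    using assms unfolding simplex_def by blast
  then have "\<not> affine_dependent ((+) a ` C)" "int (card ((+) a ` C)) = k + 1"
      "(+) a ` P = convex hull ((+) a ` C)"
    by (auto simp: affine_dependent_translation_eq[symmetric] card_image convex_hull_translation)
  then show ?thesis unfolding simplex_def by blast
qed

lemma simplicial_polytope_translation:
  fixes P :: "'a::euclidean_space set"
  assumes "simplicial_polytope d P"
  shows "simplicial_polytope d ((+) a ` P)"
proof -
  have "(int d - 1) simplex F" if F: "F facet_of (+) a ` P" for F
  proof -
    define G where "G = (+) (- a) ` F"
    have FG: "F = (+) a ` G" by (simp add: G_def image_image)
    with F have "G facet_of P" by (simp add: facet_of_def aff_dim_translation_eq)
    then have "(int d - 1) simplex G" using assms by (simp add: simplicial_polytope_def)
    then show ?thesis unfolding FG by (rule simplex_translation)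
  qed
  then show ?thesis
    using assms by (simp add: simplicial_polytope_def aff_dim_translation_eq polytope_translation_eq)
qed

lemma independent_affine_independent:
  fixes C :: "'a::euclidean_space set"
  assumes "\<not> affine_dependent C" "0 \<notin> affine hull C"
  shows "independent C"
proof
  assume "dependent C"
  then have "dependent {x - 0 |x. x \<in> C}" by simp
  moreover have "0 \<notin> C" using assms hull_inc by metis
  ultimately have "affine_dependent (insert 0 C)" by (rule dependent_imp_affine_dependent)
  then show False using affine_independent_insert assms by blast
qed

definition facet_vertices :: "'a::euclidean_space set \<Rightarrow> 'a set set" where
  "facet_vertices P = {C. \<not> affine_dependent C \<and> convex hull C facet_of P}"

text \<open>Positive dimension ensures that facets exist: a single point has none, since the empty
  face does not count as a facet, and its fan would contain no cone at all.\<close>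

locale centered_simplicial_polytope =
  fixes P :: "'a::euclidean_space set" and d :: nat
  assumes simplicial: "simplicial_polytope d P" and zero: "0 \<in> rel_interior P" and d_pos: "0 < d"
begin

lemma polytope: "polytope P" and aff_dim: "aff_dim P = int d"
  using simplicial by (auto simp: simplicial_polytope_def)

lemma polyhedron: "polyhedron P"
  using polytope by (rule polytope_imp_polyhedron)

lemma convex: "convex P"
  using polytope by (rule polytope_imp_convex)

lemma zero_in: "0 \<in> P"
  using zero rel_interior_subset by blast

lemma span_eq_affine: "span P = affine hull P"
  using affine_hull_span_0 hull_inc zero_in by metis

lemma dim_eq: "dim P = d"
  using aff_dim_zero[of P] aff_dim zero_in hull_inc[of 0 P affine] by simp

lemma facet_obtain:
  assumes "F facet_of P"
  obtains C where "C \<in> facet_vertices P" "F = convex hull C"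
  using simplicial assms unfolding simplicial_polytope_def simplex_def facet_vertices_def by blast

lemma facet_vertices_facts:
  assumes C: "C \<in> facet_vertices P"
  shows "finite C" "card C = d" "independent C" "span C = span P"
    and "\<And>y. y \<in> convex hull C \<Longrightarrow> y \<in> rel_frontier P"
    and "0 \<notin> affine hull C"
proof -
  have aff: "\<not> affine_dependent C" and facet: "convex hull C facet_of P"
    using C by (auto simp: facet_vertices_def)
  show fin: "finite C" using aff aff_independent_finite by blast
  have "aff_dim (convex hull C) = int d - 1"
    using facet aff_dim by (simp add: facet_of_def)
  then show card: "card C = d"
    using aff_dim_affine_independent[OF aff] by (simp add: aff_dim_convex_hull)
  show "y \<in> rel_frontier P" if "y \<in> convex hull C" for y
    using that facet rel_frontier_of_polyhedron[OF polyhedron] by blast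
  have face: "convex hull C face_of P" "convex hull C \<noteq> P"
    using facet aff_dim by (auto simp: facet_of_def)
  \<comment> \<open>A face is the intersection of the polytope with the affine hull of the face, and
    a proper face misses the relative interior, where the origin lies.\<close>
  show zero_not: "0 \<notin> affine hull C"
  proof
    assume "0 \<in> affine hull C"
    then have "0 \<in> convex hull C"
      using face_of_imp_eq_affine_Int[OF convex face(1)] zero_in by simp
    then show False using face_of_disjoint_rel_interior[OF face] zero by blast
  qed
  show indep: "independent C" by (rule independent_affine_independent[OF aff zero_not])
  have "C \<subseteq> P" by (rule subset_trans[OF hull_subset face_of_imp_subset[OF face(1)]])
  moreover from this have "P \<subseteq> span C"
    using card_ge_dim_independent[OF _ indep, of P] card dim_eq by simp
  ultimately show "span C = span P"
    by (simp add: span_eq span_superset subset_trans[OF _ span_superset])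
qed

text \<open>Shrinking a point of the closure towards the relatively interior point \<open>0\<close>
  leads into the relative interior, so a frontier point has no frontier point strictly below it on
  its ray. A factor above \<open>1\<close> is inverted.\<close>

lemma ray_unique:
  assumes "x \<in> rel_frontier P" "r *\<^sub>R x \<in> rel_frontier P" "0 < r"
  shows "r = 1"
proof -
  have *: "\<not> s < 1" if "y \<in> rel_frontier P" "s *\<^sub>R y \<in> rel_frontier P" "0 < s" for s y
  proof
    assume "s < 1"
    have "y \<in> closure P" using that by (simp add: rel_frontier_def)
    then have "y - (1 - s) *\<^sub>R (y - 0) \<in> rel_interior P"
      using that \<open>s < 1\<close> by (intro rel_interior_closure_convex_shrink[OF convex zero]) auto
    then show False using that by (simp add: rel_frontier_def algebra_simps)
  qed
  have "\<not> r < 1" using * assms by blast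
  moreover have "\<not> inverse r < 1" using *[of "r *\<^sub>R x" "inverse r"] assms by simp
  ultimately show ?thesis using assms(3) by (simp add: inverse_eq_divide divide_less_eq)
qed

text \<open>Scaling the nonzero coordinates to sum \<open>1\<close> turns \<open>y\<close> into a
  convex combination of its support with positive coefficients. This translates supports into faces
  having the scaled vector in their relative interior.\<close>

lemma cone_hits_frontier:
  assumes C: "C \<in> facet_vertices P" and y: "y \<in> span P" "y \<noteq> 0"
    and nonneg: "\<forall>u\<in>C. 0 \<le> representation C y u"
  defines "T \<equiv> {u \<in> C. representation C y u \<noteq> 0}"
  obtains s where "0 < s" "s *\<^sub>R y \<in> rel_frontier P" "s *\<^sub>R y \<in> rel_interior (convex hull T)"
    "convex hull T face_of P" "\<not> affine_dependent T"
proof -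
  note facts = facet_vertices_facts[OF C]
  have aff: "\<not> affine_dependent C" and facet: "convex hull C face_of P"
    using C by (auto simp: facet_vertices_def facet_of_def)
  have TC: "T \<subseteq> C" by (auto simp: T_def)
  have affT: "\<not> affine_dependent T" using aff TC affine_independent_subset by blast
  have finT: "finite T" using facts(1) TC finite_subset by blast
  have rep: "(\<Sum>u\<in>T. representation C y u *\<^sub>R u) = y"
  proof -
    have "(\<Sum>u\<in>C. representation C y u *\<^sub>R u) = y"
      using sum_representation_eq[OF facts(3), of y C] facts y by simp
    moreover have "(\<Sum>u\<in>T. representation C y u *\<^sub>R u) = (\<Sum>u\<in>C. representation C y u *\<^sub>R u)"
      by (rule sum.mono_neutral_left) (use facts(1) in \<open>auto simp: T_def\<close>)
    ultimately show ?thesis by simp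
  qed
  have pos: "0 < representation C y u" if "u \<in> T" for u
    using that nonneg by (auto simp: T_def less_le)
  have "T \<noteq> {}" using rep y by auto
  define q where "q = (\<Sum>u\<in>T. representation C y u)"
  have q: "0 < q" unfolding q_def using pos finT \<open>T \<noteq> {}\<close> by (intro sum_pos) auto
  have "inverse q *\<^sub>R y \<in> rel_interior (convex hull T)"
    unfolding rel_interior_convex_hull_explicit[OF affT]
  proof (rule CollectI, rule exI[of _ "\<lambda>u. inverse q * representation C y u"], intro conjI ballI)
    show "(\<Sum>u\<in>T. inverse q * representation C y u) = 1"
      using q by (simp add: sum_distrib_left[symmetric] q_def[symmetric])
    show "(\<Sum>u\<in>T. (inverse q * representation C y u) *\<^sub>R u) = inverse q *\<^sub>R y"
      by (subst (2) rep[symmetric]) (simp add: scaleR_sum_right)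
  qed (use pos q in auto)
  moreover have "convex hull T face_of P"
    by (rule face_of_trans[OF face_of_convex_hull_affine_independent[OF aff, THEN iffD2] facet])
       (use TC in blast)
  moreover have "inverse q *\<^sub>R y \<in> rel_frontier P"
    using calculation(1) facts(5) rel_interior_subset hull_mono[OF TC] by blast
  ultimately show ?thesis using that[of "inverse q"] q affT by simp
qed

sublocale fan: complete_simplicial_fan "span P" "facet_vertices P" d
proof
  have "inj_on (\<lambda>C. convex hull C) (facet_vertices P)"
    by (rule inj_onI, rule convex_hull_affine_independent_inj) (auto simp: facet_vertices_def)
  moreover have "(\<lambda>C. convex hull C) ` facet_vertices P \<subseteq> {F. F face_of P}"
    by (auto simp: facet_vertices_def facet_of_def)
  ultimately show "finite (facet_vertices P)"
    using finite_polytope_faces[OF polytope] by (meson finite_imageD finite_subset)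
  show "finite V" "card V = d" "independent V" "span V = span P" if "V \<in> facet_vertices P" for V
    using facet_vertices_facts[OF that] by auto
  show "subspace (span P)" by simp
next
  have frontier: "\<exists>V\<in>facet_vertices P. x \<in> convex hull V" if "x \<in> rel_frontier P" for x
    using that facet_obtain unfolding rel_frontier_of_polyhedron[OF polyhedron] by blast
  have ex: "\<exists>V\<in>facet_vertices P. \<forall>u\<in>V. 0 \<le> representation V y u" if y: "y \<in> span P" "y \<noteq> 0" for y
  proof -
    have "0 + y \<in> affine hull P" using y span_eq_affine by simp
    then obtain t where t: "0 < t" "t *\<^sub>R y \<in> rel_frontier P"
      using ray_to_rel_frontier[OF polytope_imp_bounded[OF polytope] zero _ y(2)] by (metis add_0)
    then obtain V where V: "V \<in> facet_vertices P" "t *\<^sub>R y \<in> convex hull V" using frontier by blast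
    note facts = facet_vertices_facts[OF V(1)]
    obtain c where c: "\<forall>u\<in>V. 0 \<le> c u" "(\<Sum>u\<in>V. c u *\<^sub>R u) = t *\<^sub>R y"
      using V(2) unfolding convex_hull_finite[OF facts(1)] by auto
    have "representation V (t *\<^sub>R y) u = c u" if u: "u \<in> V" for u
    proof -
      have "representation V (t *\<^sub>R y) u = (\<Sum>w\<in>V. c w * representation V w u)"
        unfolding c(2)[symmetric] using facts(3)
        by (subst representation_sum) (auto intro!: span_scale intro: span_base simp: representation_scale span_base)
      also have "\<dots> = c u"
        using facts(1,3) u by (simp add: representation_basis if_distrib cong: if_cong)
      finally show ?thesis .
    qed
    then have "\<forall>u\<in>V. 0 \<le> t * representation V y u"
      using c(1) facts y by (simp add: representation_scale)
    then show ?thesis using V(1) t(1) by (auto simp: zero_le_mult_iff)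
  qed
  show "\<exists>V\<in>facet_vertices P. \<forall>u\<in>V. 0 \<le> representation V y u" if y: "y \<in> span P" for y
  proof (cases "y = 0")
    case True
    \<comment> \<open>Every cone contains \<open>0\<close>, so it only remains to find some facet; a
      nonzero point of the polytope leads to one.\<close>
    have "\<not> P \<subseteq> {0}" using dim_eq d_pos by (metis dim_eq_0 not_gr_zero)
    then obtain z where "z \<in> P" "z \<noteq> 0" by blast
    then obtain V where "V \<in> facet_vertices P" using ex[of z] span_base by blast
    then show ?thesis by (intro bexI[of _ V]) (auto simp: True representation_zero)
  qed (use ex y in blast)
next
  fix V W y
  assume V: "V \<in> facet_vertices P" and W: "W \<in> facet_vertices P" and y: "y \<in> span P"
    and nonneg: "\<forall>u\<in>V. 0 \<le> representation V y u" "\<forall>u\<in>W. 0 \<le> representation W y u"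
  show "{u \<in> V. representation V y u \<noteq> 0} = {u \<in> W. representation W y u \<noteq> 0}"
  proof (cases "y = 0")
    case True
    then show ?thesis by (simp add: representation_zero)
  next
    case False
    obtain s where s: "0 < s" "s *\<^sub>R y \<in> rel_frontier P"
        "s *\<^sub>R y \<in> rel_interior (convex hull {u \<in> V. representation V y u \<noteq> 0})"
        "convex hull {u \<in> V. representation V y u \<noteq> 0} face_of P"
        "\<not> affine_dependent {u \<in> V. representation V y u \<noteq> 0}"
      by (rule cone_hits_frontier[OF V y False nonneg(1)])
    obtain r where r: "0 < r" "r *\<^sub>R y \<in> rel_frontier P"
        "r *\<^sub>R y \<in> rel_interior (convex hull {u \<in> W. representation W y u \<noteq> 0})"
        "convex hull {u \<in> W. representation W y u \<noteq> 0} face_of P"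
        "\<not> affine_dependent {u \<in> W. representation W y u \<noteq> 0}"
      by (rule cone_hits_frontier[OF W y False nonneg(2)])
    \<comment> \<open>Both multiples of \<open>y\<close> lie on the frontier and hence agree; two
      faces with a common relatively interior point are equal.\<close>
    have "r / s = 1"
      by (rule ray_unique[OF s(2)]) (use r s in auto)
    then have "r = s" using s(1) by simp
    then have "convex hull {u \<in> V. representation V y u \<noteq> 0} = convex hull {u \<in> W. representation W y u \<noteq> 0}"
      using s r by (intro face_of_eq[of _ P]) auto
    then show ?thesis by (rule convex_hull_affine_independent_inj[OF s(5) r(5)])
  qed
qed

text \<open>Position \<open>Suc i\<close> holds \<open>f_{i-1}\<close>, which counts the faces with
  \<open>i\<close> vertices. The bound on \<open>i\<close> excludes the polytope itself, which
  corresponds to no cone.\<close>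

lemma f_pos_eq:
  assumes "i \<le> d"
  shows "f_pos P (Suc i) = card {\<tau> \<in> fan.cones. card \<tau> = i}"
proof -
  have aff: "\<not> affine_dependent \<tau>" if \<tau>: "\<tau> \<in> fan.cones" for \<tau>
  proof -
    obtain V where "V \<in> facet_vertices P" "\<tau> \<subseteq> V" using \<tau> by (auto simp: fan.cones_def)
    then show ?thesis using affine_independent_subset by (auto simp: facet_vertices_def)
  qed
  have face: "convex hull \<tau> face_of P" if \<tau>: "\<tau> \<in> fan.cones" for \<tau>
  proof -
    obtain V where "V \<in> facet_vertices P" and \<tau>V: "\<tau> \<subseteq> V" using \<tau> by (auto simp: fan.cones_def)
    then have V: "\<not> affine_dependent V" "convex hull V face_of P"
      by (auto simp: facet_vertices_def facet_of_def)
    have "convex hull \<tau> face_of convex hull V"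
      using face_of_convex_hull_affine_independent[OF V(1)] \<tau>V by blast
    then show ?thesis using V(2) face_of_trans by blast
  qed
  have "bij_betw (\<lambda>\<tau>. convex hull \<tau>) {\<tau> \<in> fan.cones. card \<tau> = i} {F. F face_of P \<and> aff_dim F = int i - 1}"
    unfolding bij_betw_def
  proof
    show "inj_on (\<lambda>\<tau>. convex hull \<tau>) {\<tau> \<in> fan.cones. card \<tau> = i}"
      by (rule inj_onI) (use aff convex_hull_affine_independent_inj in blast)
    show "(\<lambda>\<tau>. convex hull \<tau>) ` {\<tau> \<in> fan.cones. card \<tau> = i} = {F. F face_of P \<and> aff_dim F = int i - 1}"
    proof (intro equalityI subsetI)
      fix F assume "F \<in> (\<lambda>\<tau>. convex hull \<tau>) ` {\<tau> \<in> fan.cones. card \<tau> = i}"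
      then obtain \<tau> where \<tau>: "\<tau> \<in> fan.cones" "card \<tau> = i" "F = convex hull \<tau>" by blast
      then show "F \<in> {F. F face_of P \<and> aff_dim F = int i - 1}"
        using face aff_dim_affine_independent[OF aff[OF \<tau>(1)]] by (simp add: aff_dim_convex_hull)
    next
      fix F assume "F \<in> {F. F face_of P \<and> aff_dim F = int i - 1}"
      then have F: "F face_of P" "aff_dim F = int i - 1" by auto
      have "F \<noteq> P" using F(2) aff_dim assms by auto
      have "\<exists>G. G facet_of P \<and> F \<subseteq> G"
      \<comment> \<open>The empty face lies in any facet, and completeness of the fan at
        \<open>0\<close> supplies one.\<close>
      proof (cases "F = {}")
        case True
        obtain V where "V \<in> facet_vertices P" using fan.complete[OF span_0] by blast
        then show ?thesis using True by (auto simp: facet_vertices_def)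
      next
        case False
        then show ?thesis
          using face_of_polyhedron_subset_facet[OF polyhedron F(1) _ \<open>F \<noteq> P\<close>] by blast
      qed
      then obtain G where G: "G facet_of P" "F \<subseteq> G" by blast
      obtain V where V: "V \<in> facet_vertices P" "G = convex hull V" using facet_obtain[OF G(1)] by blast
      have affV: "\<not> affine_dependent V" using V by (simp add: facet_vertices_def)
      have "F face_of convex hull V"
        using face_of_face[of G P] F(1) G V(2) by (auto simp: facet_of_def)
      then obtain \<tau> where \<tau>: "\<tau> \<subseteq> V" "F = convex hull \<tau>"
        using face_of_convex_hull_affine_independent[OF affV] by blast
      then have cone: "\<tau> \<in> fan.cones" using V by (auto simp: fan.cones_def)
      have "card \<tau> = i"
        using aff_dim_affine_independent[OF aff[OF cone]] F(2) \<tau>(2) by (simp add: aff_dim_convex_hull)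
      then show "F \<in> (\<lambda>\<tau>. convex hull \<tau>) ` {\<tau> \<in> fan.cones. card \<tau> = i}"
        using cone \<tau>(2) by blast
    qed
  qed
  then show ?thesis by (simp add: f_pos_def f_num_def bij_betw_same_card)
qed

end

theorem dehn_sommerville:
  fixes P :: "'a::euclidean_space set" and t :: real
  assumes "simplicial_polytope d P" "0 < d"
  shows "(\<Sum>i\<le>d. real (f_pos P (Suc i)) * (- 1 - t) ^ i) =
    (- 1) ^ d * (\<Sum>i\<le>d. real (f_pos P (Suc i)) * t ^ i)"
proof -
  have "P \<noteq> {}" using assms by (auto simp: simplicial_polytope_def)
  moreover have convex: "convex P" using assms by (simp add: simplicial_polytope_def polytope_imp_convex)
  ultimately obtain p where p: "p \<in> rel_interior P"
    using rel_interior_eq_empty by blast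
  define Q where "Q = (+) (- p) ` P"
  have f: "f_pos P i = f_pos Q i" for i
    unfolding f_pos_def Q_def f_num_translation ..
  interpret Q: centered_simplicial_polytope Q d
  proof
    show "simplicial_polytope d Q" unfolding Q_def by (rule simplicial_polytope_translation[OF assms(1)])
    show "0 \<in> rel_interior Q" using p unfolding Q_def rel_interior_translation by force
  qed (fact assms(2))
  have "(\<Sum>i\<le>d. real (f_pos P (Suc i)) * s ^ i) = (\<Sum>\<tau>\<in>Q.fan.cones. s ^ card \<tau>)" for s :: real
  proof -
    have "card \<tau> \<le> d" if "\<tau> \<in> Q.fan.cones" for \<tau>
      using that Q.fan.finite_gens Q.fan.card_gens by (auto simp: Q.fan.cones_def intro: card_mono)
    then have "card ` Q.fan.cones \<subseteq> {..d}" by auto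
    then have "(\<Sum>\<tau>\<in>Q.fan.cones. s ^ card \<tau>) = (\<Sum>i\<le>d. \<Sum>\<tau> | \<tau> \<in> Q.fan.cones \<and> card \<tau> = i. s ^ card \<tau>)"
      by (intro sum.group[symmetric] Q.fan.finite_cones_set) auto
    also have "\<dots> = (\<Sum>i\<le>d. real (f_pos P (Suc i)) * s ^ i)"
      by (intro sum.cong refl) (simp add: f Q.f_pos_eq)
    finally show ?thesis ..
  qed
  then show ?thesis using Q.fan.f_polynomial_symmetric by simp
qed

section \<open>Cyclic polytopes\<close>

text \<open>In general position \<open>Suc d\<close> points already have affine dimension
  \<open>d\<close>, so a set of smaller dimension has too few points to be dependent. This makes the
  proper faces of a cyclic polytope simplices.\<close>

lemma aff_dim_less_imp_affine_independent:
  fixes S :: "'a::euclidean_space set"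
  assumes "finite S" "aff_dim S < int d"
    and "\<And>T. T \<subseteq> S \<Longrightarrow> card T \<le> Suc d \<Longrightarrow> \<not> affine_dependent T"
  shows "\<not> affine_dependent S" "int (card S) = aff_dim S + 1"
proof -
  have "card S \<le> Suc d"
  proof (rule ccontr)
    assume "\<not> card S \<le> Suc d"
    then have "Suc d \<le> card S" by simp
    then obtain T where T: "T \<subseteq> S" "card T = Suc d"
      by (rule obtain_subset_with_card_n)
    then have "aff_dim T = int d"
      using aff_dim_affine_independent[OF assms(3)[OF T(1)]] by simp
    then show False using aff_dim_subset[OF T(1)] assms(2) by simp
  qed
  then show "\<not> affine_dependent S" using assms(3) by blast
  then show "int (card S) = aff_dim S + 1" using aff_dim_affine_independent[of S] by simp
qed

definition moment_curve :: "nat \<Rightarrow> (nat \<Rightarrow> 'a::euclidean_space) \<Rightarrow> real \<Rightarrow> 'a" where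
  "moment_curve d b t = (\<Sum>k<d. t ^ Suc k *\<^sub>R b k)"

locale moment_curve_polytope =
  fixes n :: nat and b :: "nat \<Rightarrow> 'a::euclidean_space" and N :: nat
  assumes b_Basis: "b ` {..<2 * n} \<subseteq> Basis" and b_inj: "inj_on b {..<2 * n}"
    and N: "2 * n < N" and n_pos: "0 < n"
begin

definition x :: "nat \<Rightarrow> 'a" where
  "x m = moment_curve (2 * n) b (real m)"

text \<open>The linear functional whose values on the curve are those of \<open>q\<close> without its
  constant coefficient.\<close>

definition functional :: "real poly \<Rightarrow> 'a" where
  "functional q = (\<Sum>k<2 * n. coeff q (Suc k) *\<^sub>R b k)"

lemma inner_b: "j < 2 * n \<Longrightarrow> k < 2 * n \<Longrightarrow> b j \<bullet> b k = (if j = k then 1 else 0)"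
  using b_Basis b_inj by (subst inner_Basis) (auto simp: inj_on_eq_iff)

lemma functional_x:
  assumes "degree q \<le> 2 * n"
  shows "functional q \<bullet> x m = poly q (real m) - coeff q 0"
proof -
  have inner_x: "b j \<bullet> x m = real m ^ Suc j" if j: "j < 2 * n" for j
  proof -
    have "b j \<bullet> x m = (\<Sum>k<2 * n. real m ^ Suc k * (b j \<bullet> b k))"
      by (simp add: x_def moment_curve_def inner_sum_right del: power_Suc)
    also have "\<dots> = (\<Sum>k<2 * n. if j = k then real m ^ Suc j else 0)"
      by (intro sum.cong refl) (simp add: inner_b j)
    also have "\<dots> = real m ^ Suc j" using j by simp
    finally show ?thesis .
  qed
  have "functional q \<bullet> x m = (\<Sum>j<2 * n. coeff q (Suc j) * real m ^ Suc j)"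
    unfolding functional_def inner_sum_left by (intro sum.cong refl) (simp add: inner_x)
  also have "\<dots> = (\<Sum>j\<le>2 * n. coeff q j * real m ^ j) - coeff q 0"
    by (subst lessThan_Suc_atMost[symmetric], subst sum.lessThan_Suc_shift) simp
  also have "(\<Sum>j\<le>2 * n. coeff q j * real m ^ j) = poly q (real m)"
    unfolding poly_altdef
    by (rule sum.mono_neutral_right) (use assms in \<open>auto simp: coeff_eq_0\<close>)
  finally show ?thesis .
qed

lemma inj_x: "inj x"
proof (rule injI)
  fix i j assume "x i = x j"
  \<comment> \<open>The polynomial \<open>t\<close> reads off the parameter; its degree is
    admissible because \<open>n\<close> is positive.\<close>
  then have "functional [:0, 1:] \<bullet> x i = functional [:0, 1:] \<bullet> x j" by simp
  then show "i = j" using n_pos by (simp add: functional_x)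
qed

text \<open>The polynomial with roots at all parameters but \<open>m\<close> isolates the
  coefficient of \<open>x m\<close> in an affine relation. The constant term that
  \<open>functional\<close> lacks is harmless because the coefficients of the relation sum to
  zero.\<close>

lemma affine_independent_x:
  assumes "finite T" "card T \<le> Suc (2 * n)"
  shows "\<not> affine_dependent (x ` T)"
proof
  assume "affine_dependent (x ` T)"
  then obtain c where c: "sum c (x ` T) = 0" "\<exists>v\<in>x ` T. c v \<noteq> 0" "(\<Sum>v\<in>x ` T. c v *\<^sub>R v) = 0"
    using affine_dependent_explicit_finite[of "x ` T"] assms(1) by blast
  have inj: "inj_on x T" using inj_x inj_on_subset by blast
  obtain m where m: "m \<in> T" "c (x m) \<noteq> 0" using c(2) by blast
  define q where "q = (\<Prod>i\<in>T - {m}. [:- real i, 1:])"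
  have "degree q = card (T - {m})"
    unfolding q_def by (subst degree_prod_eq_sum_degree) auto
  then have deg: "degree q \<le> 2 * n" using assms m by simp
  have q0: "poly q (real i) = 0" if "i \<in> T" "i \<noteq> m" for i
    unfolding q_def poly_prod using assms(1) that by (intro prod_zero) auto
  have qm: "poly q (real m) \<noteq> 0"
    unfolding q_def poly_prod using assms(1) by auto
  have "0 = functional q \<bullet> (\<Sum>v\<in>x ` T. c v *\<^sub>R v) + coeff q 0 * sum c (x ` T)"
    using c by simp
  also have "\<dots> = (\<Sum>i\<in>T. c (x i) * (functional q \<bullet> x i)) + coeff q 0 * (\<Sum>i\<in>T. c (x i))"
    by (simp add: sum.reindex[OF inj] inner_sum_right)
  also have "\<dots> = (\<Sum>i\<in>T. c (x i) * poly q (real i))"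
    by (simp add: functional_x[OF deg] algebra_simps sum_subtractf sum_distrib_left)
  also have "\<dots> = (\<Sum>i\<in>T. if i = m then c (x m) * poly q (real m) else 0)"
    by (intro sum.cong refl) (auto simp: q0)
  also have "\<dots> = c (x m) * poly q (real m)" using m assms(1) by simp
  finally show False using m qm by simp
qed

definition X :: "'a set" where "X = x ` {..<N}"

lemma finite_X: "finite X"
  by (simp add: X_def)

lemma subset_XE:
  assumes "T \<subseteq> X"
  obtains A where "A \<subseteq> {..<N}" "T = x ` A"
  using assms unfolding X_def by (metis subset_image_iff)

lemma affine_independent_subset_X:
  assumes "T \<subseteq> X" "card T \<le> Suc (2 * n)"
  shows "\<not> affine_dependent T"
proof -
  obtain A where A: "A \<subseteq> {..<N}" "T = x ` A" using subset_XE[OF assms(1)] .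
  have "card T = card A" using A(2) inj_x card_image inj_on_subset subset_UNIV by metis
  then show ?thesis
    using affine_independent_x[of A] A assms(2) finite_subset[OF A(1)] by simp
qed

lemma aff_dim_X: "aff_dim X = 2 * int n"
proof (rule antisym)
  have "x m \<in> span (b ` {..<2 * n})" for m
    unfolding x_def moment_curve_def by (intro span_sum span_scale span_base) auto
  then have "aff_dim X \<le> aff_dim (span (b ` {..<2 * n}))"
    by (intro aff_dim_subset) (auto simp: X_def)
  also have "\<dots> = int (dim (b ` {..<2 * n}))" by (simp add: aff_dim_subspace)
  also have "\<dots> \<le> 2 * int n"
    using dim_le_card'[of "b ` {..<2 * n}"] card_image_le[of "{..<2 * n}" b] by simp
  finally show "aff_dim X \<le> 2 * int n" .
  have "x ` {..<Suc (2 * n)} \<subseteq> X" using N by (auto simp: X_def)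
  then have "aff_dim (x ` {..<Suc (2 * n)}) \<le> aff_dim X" by (rule aff_dim_subset)
  moreover have "card (x ` {..<Suc (2 * n)}) = Suc (2 * n)"
    using inj_x by (subst card_image) (auto intro: inj_on_subset)
  ultimately show "2 * int n \<le> aff_dim X"
    using aff_dim_affine_independent[OF affine_independent_x[of "{..<Suc (2 * n)}"]] by simp
qed

lemma face_obtain:
  assumes F: "F face_of convex hull X" and dim: "aff_dim F < 2 * int n"
  obtains A where "A \<subseteq> {..<N}" "F = convex hull (x ` A)" "\<not> affine_dependent (x ` A)"
    "int (card A) = aff_dim F + 1"
proof -
  obtain T where T: "T \<subseteq> X" "F = convex hull T"
    using face_of_convex_hull_subset[OF finite_imp_compact[OF finite_X] F] .
  obtain A where A: "A \<subseteq> {..<N}" "T = x ` A" using subset_XE[OF T(1)] .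
  have aff: "\<not> affine_dependent T" "int (card T) = aff_dim T + 1"
    using aff_dim_less_imp_affine_independent[of T "2 * n"] finite_subset[OF T(1) finite_X]
      affine_independent_subset_X T dim by (auto simp: aff_dim_convex_hull)
  have "card T = card A" using A(2) inj_x card_image inj_on_subset subset_UNIV by metis
  with aff A T show ?thesis by (intro that[of A]) (auto simp: aff_dim_convex_hull)
qed

lemma simplicial: "simplicial_polytope (2 * n) (convex hull X)"
  unfolding simplicial_polytope_def
proof (intro conjI allI impI)
  show "polytope (convex hull X)" by (rule polytope_convex_hull[OF finite_X])
  show "aff_dim (convex hull X) = int (2 * n)" by (simp add: aff_dim_convex_hull aff_dim_X)
  fix F assume "F facet_of convex hull X"
  then have F: "F face_of convex hull X" "aff_dim F = 2 * int n - 1"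
    by (auto simp: facet_of_def aff_dim_convex_hull aff_dim_X)
  then obtain A where A: "F = convex hull (x ` A)" "\<not> affine_dependent (x ` A)"
      "int (card A) = aff_dim F + 1"
    using face_obtain[OF F(1)] by auto
  then have "int (card (x ` A)) = (int (2 * n) - 1) + 1"
    using F(2) card_image[OF inj_on_subset[OF inj_x subset_UNIV], of A] by simp
  then show "(int (2 * n) - 1) simplex F" unfolding simplex_def using A by blast
qed

text \<open>The square of the polynomial with root set \<open>A\<close> is nonnegative and vanishes
  at exactly the parameters in \<open>A\<close>, so it defines a supporting hyperplane. Squaring
  doubles the degree, whence the bound \<open>n\<close> on the number of points.\<close>

lemma neighborly:
  assumes A: "A \<subseteq> {..<N}" "card A \<le> n"
  shows "convex hull (x ` A) face_of convex hull X"
proof -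
  define q where "q = (\<Prod>i\<in>A. [:- real i, 1:]) ^ 2"
  have "degree (\<Prod>i\<in>A. [:- real i, 1:]) = card A"
    by (subst degree_prod_eq_sum_degree) auto
  then have deg: "degree q \<le> 2 * n"
    using A(2) degree_power_le[of "\<Prod>i\<in>A. [:- real i, 1:]" 2] by (simp add: q_def)
  have finA: "finite A" using A(1) finite_subset by blast
  have q_iff: "poly q (real i) = 0 \<longleftrightarrow> i \<in> A" for i
    using finA by (auto simp: q_def poly_prod)
  define a where "a = functional q"
  have a: "a \<bullet> x m = poly q (real m) - coeff q 0" for m
    unfolding a_def by (rule functional_x[OF deg])
  have "X \<subseteq> {y. - coeff q 0 \<le> a \<bullet> y}"
    by (auto simp: X_def a q_def)
  then have "convex hull X \<subseteq> {y. - coeff q 0 \<le> a \<bullet> y}"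
    by (rule hull_minimal) (use convex_halfspace_ge in \<open>simp add: convex_halfspace_ge\<close>)
  then have face: "(convex hull X \<inter> {y. a \<bullet> y = - coeff q 0}) face_of convex hull X"
    by (intro face_of_Int_supporting_hyperplane_ge) auto
  have "convex hull X \<inter> {y. a \<bullet> y = - coeff q 0} = convex hull (x ` A)"
  proof
    \<comment> \<open>A face of the hull is the hull of some of the points; those on the hyperplane
      have their parameters among the roots of \<open>q\<close>.\<close>
    obtain T where T: "T \<subseteq> X" "convex hull X \<inter> {y. a \<bullet> y = - coeff q 0} = convex hull T"
      using face_of_convex_hull_subset[OF finite_imp_compact[OF finite_X] face] .
    have "T \<subseteq> x ` A"
    proof
      fix y assume y: "y \<in> T"
      then obtain m where m: "m < N" "y = x m" using T(1) by (auto simp: X_def)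
      have "y \<in> convex hull T" using y by (rule hull_inc)
      then have "a \<bullet> y = - coeff q 0" using T(2) by blast
      then show "y \<in> x ` A" using a[of m] m(2) q_iff by auto
    qed
    then show "convex hull X \<inter> {y. a \<bullet> y = - coeff q 0} \<subseteq> convex hull (x ` A)"
      unfolding T(2) by (rule hull_mono)
    have "x ` A \<subseteq> {y. a \<bullet> y = - coeff q 0}" using a q_iff by auto
    then have "convex hull (x ` A) \<subseteq> {y. a \<bullet> y = - coeff q 0}"
      by (rule hull_minimal) (rule convex_hyperplane)
    moreover have "convex hull (x ` A) \<subseteq> convex hull X"
      using A(1) by (intro hull_mono) (auto simp: X_def)
    ultimately show "convex hull (x ` A) \<subseteq> convex hull X \<inter> {y. a \<bullet> y = - coeff q 0}" by blast
  qed
  then show ?thesis using face by simp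
qed

lemma f_pos_eq:
  assumes "i \<le> n"
  shows "f_pos (convex hull X) (Suc i) = N choose i"
proof -
  have aff: "\<not> affine_dependent (x ` A)" and card: "card (x ` A) = card A"
    if "A \<subseteq> {..<N}" "card A = i" for A
    using affine_independent_x[of A] finite_subset[OF that(1)] that(2) assms
      card_image[OF inj_on_subset[OF inj_x subset_UNIV], of A] by auto
  have "bij_betw (\<lambda>A. convex hull (x ` A)) {A. A \<subseteq> {..<N} \<and> card A = i}
      {F. F face_of convex hull X \<and> aff_dim F = int i - 1}"
    unfolding bij_betw_def
  proof
    show "inj_on (\<lambda>A. convex hull (x ` A)) {A. A \<subseteq> {..<N} \<and> card A = i}"
    proof (rule inj_onI)
      fix A B assume A: "A \<in> {A. A \<subseteq> {..<N} \<and> card A = i}" and B: "B \<in> {A. A \<subseteq> {..<N} \<and> card A = i}"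
        and eq: "convex hull (x ` A) = convex hull (x ` B)"
      have "x ` A = x ` B"
        by (rule convex_hull_affine_independent_inj[OF _ _ eq]) (use aff A B in auto)
      then show "A = B" using inj_image_eq_iff[OF inj_x] by simp
    qed
    show "(\<lambda>A. convex hull (x ` A)) ` {A. A \<subseteq> {..<N} \<and> card A = i} =
        {F. F face_of convex hull X \<and> aff_dim F = int i - 1}"
    proof (intro equalityI subsetI)
      fix F assume "F \<in> (\<lambda>A. convex hull (x ` A)) ` {A. A \<subseteq> {..<N} \<and> card A = i}"
      then obtain A where A: "A \<subseteq> {..<N}" "card A = i" "F = convex hull (x ` A)" by blast
      then show "F \<in> {F. F face_of convex hull X \<and> aff_dim F = int i - 1}"
        using neighborly[OF A(1)] assms card[OF A(1,2)] aff_dim_affine_independent[OF aff[OF A(1,2)]]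
        by (simp add: aff_dim_convex_hull)
    next
      fix F assume "F \<in> {F. F face_of convex hull X \<and> aff_dim F = int i - 1}"
      then have F: "F face_of convex hull X" "aff_dim F = int i - 1" by auto
      then obtain A where "A \<subseteq> {..<N}" "F = convex hull (x ` A)" "int (card A) = aff_dim F + 1"
        using face_obtain[OF F(1)] assms n_pos by auto
      then show "F \<in> (\<lambda>A. convex hull (x ` A)) ` {A. A \<subseteq> {..<N} \<and> card A = i}"
        using F(2) by auto
    qed
  qed
  then have "card {A. A \<subseteq> {..<N} \<and> card A = i} = f_pos (convex hull X) (Suc i)"
    by (simp add: f_pos_def f_num_def bij_betw_same_card)
  then show ?thesis using n_subsets[of "{..<N}" i] by simp
qed

end

lemma exists_neighborly_polytope:
  assumes "2 * n \<le> DIM('a::euclidean_space)" "2 * n < N"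
  shows "\<exists>P :: 'a set. simplicial_polytope (2 * n) P \<and> (\<forall>i\<le>n. f_pos P (Suc i) = N choose i)"
proof (cases "n = 0")
  case True
  \<comment> \<open>In dimension \<open>0\<close> the moment curve is replaced by a single point,
    and only \<open>f_{-1} = 1 = N choose 0\<close> is claimed.\<close>
  have "simplicial_polytope 0 {0 :: 'a}"
    using polytope_sing by (auto simp: simplicial_polytope_def facet_of_def simp flip: aff_dim_empty)
  moreover have "{F. F face_of {0 :: 'a} \<and> aff_dim F = - 1} = {{}}"
    by (auto simp flip: aff_dim_empty)
  ultimately show ?thesis
    using True by (intro exI[of _ "{0}"]) (simp add: f_pos_def f_num_def)
next
  case False
  obtain B where B: "B \<subseteq> (Basis :: 'a set)" "card B = 2 * n"
    by (rule obtain_subset_with_card_n[OF assms(1)])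
  have "finite B" using B(1) finite_Basis finite_subset by blast
  then obtain b where b: "bij_betw b {..<2 * n} B"
    using ex_bij_betw_nat_finite[of B] B(2) by (auto simp: atLeast0LessThan)
  interpret moment_curve_polytope n b N
    using b B False assms(2) by unfold_locales (auto simp: bij_betw_def)
  show ?thesis using simplicial f_pos_eq by blast
qed

section \<open>Minors of the matrix of binomial coefficients\<close>

text \<open>Multilinearity in all rows at once: in the permutation expansion every product of sums
  splits according to the set \<open>I\<close> of rows that contribute their first summand.\<close>

lemma det_rows_add_Pow:
  fixes u v :: "nat \<Rightarrow> nat \<Rightarrow> 'a::comm_ring_1"
  shows "Determinant.det (mat n n (\<lambda>(j, k). u j k + v j k)) =
    (\<Sum>I\<in>Pow {0..<n}. Determinant.det (mat n n (\<lambda>(j, k). if j \<in> I then u j k else v j k)))"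
proof -
  have *: "(\<Prod>i = 0..<n. u i (p i) + v i (p i)) =
      (\<Sum>I\<in>Pow {0..<n}. \<Prod>i = 0..<n. if i \<in> I then u i (p i) else v i (p i))" for p
  proof (subst prod_add, simp, rule sum.cong[OF refl])
    fix I assume "I \<in> Pow {0..<n}"
    then have "I \<subseteq> {0..<n}" by simp
    then show "(\<Prod>i\<in>I. u i (p i)) * (\<Prod>i\<in>{0..<n} - I. v i (p i)) =
        (\<Prod>i = 0..<n. if i \<in> I then u i (p i) else v i (p i))"
      by (simp add: prod.If_cases Int_absorb1 Diff_eq Int_commute)
         (simp add: Int_absorb2)
  qed
  have "Determinant.det (mat n n (\<lambda>(j, k). u j k + v j k)) =
      (\<Sum>p | p permutes {0..<n}. signof p * (\<Prod>i = 0..<n. u i (p i) + v i (p i)))"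
    by (subst det_def'[of _ n]) (auto intro!: sum.cong prod.cong)
  also have "\<dots> = (\<Sum>p | p permutes {0..<n}. \<Sum>I\<in>Pow {0..<n}.
      signof p * (\<Prod>i = 0..<n. if i \<in> I then u i (p i) else v i (p i)))"
    by (simp add: * sum_distrib_left)
  also have "\<dots> = (\<Sum>I\<in>Pow {0..<n}. \<Sum>p | p permutes {0..<n}.
      signof p * (\<Prod>i = 0..<n. if i \<in> I then u i (p i) else v i (p i)))"
    by (rule sum.swap)
  also have "\<dots> = (\<Sum>I\<in>Pow {0..<n}. Determinant.det (mat n n (\<lambda>(j, k). if j \<in> I then u j k else v j k)))"
    by (subst det_def'[of _ n]) (auto intro!: sum.cong prod.cong)
  finally show ?thesis .
qed

text \<open>The lower argument may be negative, because Pascal's rule shifts it below zero in the minors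
  considered here.\<close>

definition ibinom :: "nat \<Rightarrow> int \<Rightarrow> real" where
  "ibinom b x = (if 0 \<le> x then real (b choose nat x) else 0)"

lemma ibinom_pascal:
  assumes "0 < b"
  shows "ibinom b x = ibinom (b - 1) (x - 1) + ibinom (b - 1) x"
proof -
  obtain c where b: "b = Suc c" using assms by (cases b) auto
  consider "x < 0" | "x = 0" | "0 < x" by linarith
  then show ?thesis
  proof cases
    case 3
    then have "nat x = Suc (nat (x - 1))" by simp
    with 3 show ?thesis by (simp add: ibinom_def b)
  qed (auto simp: ibinom_def b)
qed

lemma ibinom_0: "ibinom 0 x = (if x = 0 then 1 else 0)"
  by (auto simp: ibinom_def)

text \<open>For \<open>b k = k\<close> the entry is the coefficient of \<open>t^(e j)\<close> in
  \<open>(t + t^2)^k\<close>, so rows stand for exponents and columns for powers. Other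
  \<open>b\<close> arise from Pascal's rule and from deleting the first column.\<close>

definition binom_minor :: "(nat \<Rightarrow> nat) \<Rightarrow> (nat \<Rightarrow> int) \<Rightarrow> nat \<Rightarrow> real" where
  "binom_minor b e n = Determinant.det (mat n n (\<lambda>(j, k). ibinom (b k) (e j - int k)))"

lemma binom_minor_pascal:
  assumes "\<And>k. k < n \<Longrightarrow> 0 < b k"
  shows "binom_minor b e n =
    (\<Sum>I\<in>Pow {0..<n}. binom_minor (\<lambda>k. b k - 1) (\<lambda>j. if j \<in> I then e j - 1 else e j) n)"
proof -
  have "binom_minor b e n = Determinant.det (mat n n (\<lambda>(j, k).
      ibinom (b k - 1) (e j - 1 - int k) + ibinom (b k - 1) (e j - int k)))"
    unfolding binom_minor_def
    by (rule arg_cong[where f = Determinant.det], rule eq_matI)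
       (use ibinom_pascal[OF assms] in \<open>auto simp: algebra_simps\<close>)
  also have "\<dots> = (\<Sum>I\<in>Pow {0..<n}. binom_minor (\<lambda>k. b k - 1) (\<lambda>j. if j \<in> I then e j - 1 else e j) n)"
    unfolding det_rows_add_Pow binom_minor_def
    by (intro sum.cong refl arg_cong[where f = Determinant.det], rule eq_matI) auto
  finally show ?thesis .
qed

lemma binom_minor_eq_rows:
  assumes "i < j" "j < n" "e i = e j"
  shows "binom_minor b e n = 0"
  unfolding binom_minor_def
  by (rule det_identical_rows[of _ n i j]) (use assms in \<open>auto simp: row_def intro!: eq_vecI\<close>)

text \<open>As \<open>b 0 = 0\<close>, column \<open>0\<close> has an entry \<open>1\<close> exactly
  in rows with \<open>e j = 0\<close>. If the smallest exponent \<open>e 0\<close> is negative, row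
  \<open>0\<close> vanishes; if it is positive, column \<open>0\<close> vanishes; otherwise
  expansion leaves one minor, and the shift of column indices lowers the exponents by one.\<close>

lemma binom_minor_Suc:
  assumes b0: "b 0 = 0" and e: "\<And>j. 0 < j \<Longrightarrow> j \<le> m \<Longrightarrow> e 0 < e j"
  shows "binom_minor b e (Suc m) =
    (if e 0 = 0 then binom_minor (\<lambda>k. b (Suc k)) (\<lambda>j. e (Suc j) - 1) m else 0)"
proof -
  let ?A = "mat (Suc m) (Suc m) (\<lambda>(j, k). ibinom (b k) (e j - int k))"
  have A: "?A \<in> carrier_mat (Suc m) (Suc m)" by simp
  show ?thesis
  proof (cases "e 0 < 0")
    case True
    have "Determinant.det ?A = (\<Sum>k<Suc m. ?A $$ (0, k) * cofactor ?A 0 k)"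
      by (rule laplace_expansion_row[OF A]) simp
    also have "\<dots> = 0"
      by (rule sum.neutral) (use True in \<open>auto simp: ibinom_def\<close>)
    finally show ?thesis using True by (simp add: binom_minor_def)
  next
    case False
    have "Determinant.det ?A = (\<Sum>j<Suc m. ?A $$ (j, 0) * cofactor ?A j 0)"
      by (rule laplace_expansion_column[OF A]) simp
    also have "\<dots> = (\<Sum>j\<in>{0}. ?A $$ (j, 0) * cofactor ?A j 0)"
    proof (rule sum.mono_neutral_right)
      show "\<forall>j\<in>{..<Suc m} - {0}. ?A $$ (j, 0) * cofactor ?A j 0 = 0"
        using False e b0 by (force simp: ibinom_0)
    qed auto
    also have "\<dots> = (if e 0 = 0 then Determinant.det (mat_delete ?A 0 0) else 0)"
      using b0 by (simp add: ibinom_0 cofactor_def)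
    also have "mat_delete ?A 0 0 = mat m m (\<lambda>(j, k). ibinom (b (Suc k)) (e (Suc j) - 1 - int k))"
      by (rule eq_matI) (auto simp: mat_delete_def algebra_simps)
    finally show ?thesis by (simp add: binom_minor_def)
  qed
qed

text \<open>The inequalities say that the diagonal entries are nonzero. If \<open>b 0 = 0\<close>,
  the first column is split off; otherwise monotonicity makes all upper arguments positive and
  Pascal's rule applies. Lowering some of the strictly increasing integers by one can at worst
  create a tie, so each term has two equal rows or is covered by induction, and nothing
  cancels.\<close>

lemma binom_minor_pos:
  assumes "\<And>j k. j \<le> k \<Longrightarrow> k < n \<Longrightarrow> b j \<le> b k" and "\<And>j k. j < k \<Longrightarrow> k < n \<Longrightarrow> e j < e k"
  shows "0 \<le> binom_minor b e n \<and>
    ((\<forall>k<n. int k \<le> e k \<and> e k \<le> int k + int (b k)) \<longrightarrow> 0 < binom_minor b e n)"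
  using assms
proof (induction "n + (\<Sum>k<n. b k)" arbitrary: n b e rule: less_induct)
  case less
  show ?case
  proof (cases n)
    case 0
    then show ?thesis by (simp add: binom_minor_def)
  next
    case (Suc m)
    show ?thesis
    proof (cases "b 0 = 0")
      case True
      let ?b = "\<lambda>k. b (Suc k)" and ?e = "\<lambda>j. e (Suc j) - 1"
      have eq: "binom_minor b e n = (if e 0 = 0 then binom_minor ?b ?e m else 0)"
        unfolding Suc by (rule binom_minor_Suc) (use True less.prems Suc in auto)
      have "0 \<le> binom_minor ?b ?e m \<and>
          ((\<forall>k<m. int k \<le> ?e k \<and> ?e k \<le> int k + int (?b k)) \<longrightarrow> 0 < binom_minor ?b ?e m)"
      proof (rule less.hyps)
        show "m + (\<Sum>k<m. ?b k) < n + (\<Sum>k<n. b k)"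
          unfolding Suc sum.lessThan_Suc_shift by simp
      qed (use less.prems Suc in auto)
      moreover have "\<forall>k<m. int k \<le> ?e k \<and> ?e k \<le> int k + int (?b k)" "e 0 = 0"
        if "\<forall>k<n. int k \<le> e k \<and> e k \<le> int k + int (b k)"
      proof -
        show "\<forall>k<m. int k \<le> ?e k \<and> ?e k \<le> int k + int (?b k)"
        proof (intro allI impI)
          fix k assume "k < m"
          then show "int k \<le> ?e k \<and> ?e k \<le> int k + int (?b k)"
            using that[rule_format, of "Suc k"] Suc by auto
        qed
        show "e 0 = 0" using that[rule_format, of 0] Suc True by auto
      qed
      ultimately show ?thesis unfolding eq by auto
    next
      case False
      have bpos: "0 < b k" if "k < n" for k
        using less.prems(1)[of 0 k] False that by simp
      let ?b = "\<lambda>k. b k - 1" and ?e = "\<lambda>I j. if j \<in> I then e j - 1 else e j"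
      have lt: "n + (\<Sum>k<n. ?b k) < n + (\<Sum>k<n. b k)"
        using bpos Suc by (intro add_strict_left_mono sum_strict_mono) auto
      have IH: "0 \<le> binom_minor ?b (?e I) n \<and>
          ((\<forall>k<n. int k \<le> ?e I k \<and> ?e I k \<le> int k + int (?b k)) \<longrightarrow> 0 < binom_minor ?b (?e I) n)"
        if "\<And>j k. j < k \<Longrightarrow> k < n \<Longrightarrow> ?e I j < ?e I k" for I
        by (rule less.hyps[OF lt]) (use less.prems(1) that in \<open>auto intro: diff_le_mono\<close>)
      have nonneg: "0 \<le> binom_minor ?b (?e I) n" for I
      proof (cases "\<exists>j k. j < k \<and> k < n \<and> ?e I j = ?e I k")
        case True
        then show ?thesis using binom_minor_eq_rows[where e = "?e I" and b = ?b] by force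
      next
        case ne: False
        have "?e I j < ?e I k" if "j < k" "k < n" for j k
        proof -
          have "e j < e k" using less.prems(2) that by blast
          moreover have "?e I j \<noteq> ?e I k" using ne that by blast
          ultimately show ?thesis by (auto split: if_splits)
        qed
        then show ?thesis using IH by blast
      qed
      have sum: "binom_minor b e n = (\<Sum>I\<in>Pow {0..<n}. binom_minor ?b (?e I) n)"
        by (rule binom_minor_pascal[OF bpos])
      have "0 < binom_minor b e n" if h: "\<forall>k<n. int k \<le> e k \<and> e k \<le> int k + int (b k)"
      proof -
        \<comment> \<open>the expansion term in which every index that can move down does so\<close>
        define I where "I = {j\<in>{0..<n}. int j < e j}"
        have "0 < binom_minor ?b (?e I) n"
        proof (rule IH[THEN conjunct2, rule_format])
          fix j k assume jk: "j < k" "k < n"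
          have mono: "e j + int (k - j) \<le> e k"
            using jk
          proof (induction k)
            case (Suc k)
            show ?case
            proof (cases "j = k")
              case True
              then show ?thesis using less.prems(2)[of j "Suc k"] Suc.prems by simp
            next
              case False
              then show ?thesis using Suc less.prems(2)[of k "Suc k"] by simp
            qed
          qed simp
          \<comment> \<open>The critical case is that only \<open>k\<close> moves: then
            \<open>e j = j\<close>, while \<open>e k - 1\<close> is still at least
            \<open>k\<close>.\<close>
          show "?e I j < ?e I k"
            using mono jk h[rule_format, of k] h[rule_format, of j] by (auto simp: I_def)
        next
          fix k assume "k < n"
          then show "int k \<le> ?e I k \<and> ?e I k \<le> int k + int (?b k)"
            using h[rule_format, of k] bpos[of k] by (auto simp: I_def)
        qed
        also have "\<dots> \<le> binom_minor b e n"
          unfolding sum by (rule member_le_sum) (use nonneg in \<open>auto simp: I_def\<close>)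
        finally show ?thesis .
      qed
      moreover have "0 \<le> binom_minor b e n"
        unfolding sum by (rule sum_nonneg) (use nonneg in blast)
      ultimately show ?thesis by blast
    qed
  qed
qed

text \<open>The coefficient of \<open>t\<^sup>i\<close> in \<open>(t + t\<^sup>2)\<^sup>k\<close>.\<close>

definition ds_coeff :: "nat \<Rightarrow> nat \<Rightarrow> real" where
  "ds_coeff k i = (if k \<le> i then real (k choose (i - k)) else 0)"

text \<open>Strict growth gives \<open>k \<le> e k\<close>, so the upper bound completes the
  positivity condition for \<open>b k = k\<close>. The coefficients \<open>c\<close> form a vector
  in the kernel of the transposed minor.\<close>

lemma ds_coeff_columns_independent:
  fixes e :: "nat \<Rightarrow> nat" and c :: "nat \<Rightarrow> real"
  assumes strict: "\<And>j k. j < k \<Longrightarrow> k \<le> n \<Longrightarrow> e j < e k"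
    and le: "\<And>k. k \<le> n \<Longrightarrow> e k \<le> 2 * k"
    and zero: "\<And>k. k \<le> n \<Longrightarrow> (\<Sum>j\<le>n. c j * ds_coeff k (e j)) = 0"
    and "j \<le> n"
  shows "c j = 0"
proof -
  let ?A = "mat (Suc n) (Suc n) (\<lambda>(j, k). ibinom k (int (e j) - int k))"
  have A: "?A \<in> carrier_mat (Suc n) (Suc n)" by simp
  have ge: "k \<le> e k" if "k \<le> n" for k
    using that
  proof (induction k)
    case (Suc k)
    then show ?case using strict[of k "Suc k"] by simp
  qed simp
  have "0 < binom_minor (\<lambda>k. k) (\<lambda>j. int (e j)) (Suc n)"
  proof (rule binom_minor_pos[THEN conjunct2, rule_format])
    show "int (e j) < int (e k)" if "j < k" "k < Suc n" for j k
      using strict[of j k] that by simp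
    show "int k \<le> int (e k) \<and> int (e k) \<le> int k + int k" if "k < Suc n" for k
      using le[of k] ge[of k] that by simp
  qed
  then have "Determinant.det ?A\<^sup>T \<noteq> 0"
    using Determinant.det_transpose[OF A] by (simp add: binom_minor_def)
  moreover have "?A\<^sup>T *\<^sub>v Matrix.vec (Suc n) c = 0\<^sub>v (Suc n)"
  proof (rule eq_vecI)
    fix k assume "k < dim_vec (0\<^sub>v (Suc n) :: real Matrix.vec)"
    then have k: "k \<le> n" by simp
    have "ibinom k (int i - int k) = ds_coeff k i" for i
      by (auto simp: ibinom_def ds_coeff_def nat_diff_distrib simp flip: of_nat_diff)
    then show "vec_index (?A\<^sup>T *\<^sub>v Matrix.vec (Suc n) c) k = vec_index (0\<^sub>v (Suc n)) k"
      using zero[OF k] k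
      by (simp add: scalar_prod_def lessThan_Suc_atMost mult.commute atLeast0LessThan)
  qed simp
  moreover have "Matrix.vec (Suc n) c \<in> carrier_vec (Suc n)" "?A\<^sup>T \<in> carrier_mat (Suc n) (Suc n)"
    by auto
  ultimately have "Matrix.vec (Suc n) c = 0\<^sub>v (Suc n)"
    using det_0_iff_vec_prod_zero by blast
  then have "vec_index (Matrix.vec (Suc n) c) j = vec_index (0\<^sub>v (Suc n)) j" by simp
  then show ?thesis using \<open>j \<le> n\<close> by simp
qed

section \<open>Bases and Dyck paths\<close>

lemma ds_coeff_0: "ds_coeff 0 i = (if i = 0 then 1 else 0)"
  by (simp add: ds_coeff_def)

lemma ds_coeff_Suc_0: "ds_coeff (Suc k) 0 = 0"
  by (simp add: ds_coeff_def)

text \<open>Multiplication of \<open>(t + t^2)^k\<close> by \<open>t + t^2\<close>, compared at the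
  power \<open>Suc i\<close>.\<close>

lemma ds_coeff_Suc_Suc:
  "ds_coeff (Suc k) (Suc i) = ds_coeff k i + (case i of 0 \<Rightarrow> 0 | Suc m \<Rightarrow> ds_coeff k m)"
proof (cases "k < i")
  case True
  then obtain j where "i = k + Suc j" using less_imp_Suc_add by fastforce
  then show ?thesis by (simp add: ds_coeff_def)
qed (auto simp: ds_coeff_def split: nat.split)

lemma ds_coeff_eq_0: "2 * k < i \<Longrightarrow> ds_coeff k i = 0"
  by (simp add: ds_coeff_def)

text \<open>After subtracting its value at \<open>0\<close>, the polynomial vanishes at
  \<open>0\<close> and by symmetry at \<open>- 1\<close>, so \<open>t + t^2\<close> divides it. This
  divisor is itself invariant, hence so is the quotient, whose degree bound drops by two.\<close>

lemma symmetric_poly_coeff: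
  fixes p :: "real poly"
  assumes "pcompose p [:- 1, - 1:] = p" "degree p \<le> 2 * n"
  shows "\<exists>a. \<forall>i. coeff p i = (\<Sum>k\<le>n. a k * ds_coeff k i)"
  using assms
proof (induction n arbitrary: p)
  case 0
  then obtain c where "p = [:c:]" using degree_0_id[of p] by (metis le_zero_eq mult_0_right)
  then have "\<forall>i. coeff p i = (\<Sum>k\<le>0. c * ds_coeff k i)"
    by (auto simp: ds_coeff_0 coeff_pCons split: nat.split)
  then show ?case by (rule exI[of _ "\<lambda>_. c"])
next
  case (Suc n)
  define c where "c = coeff p 0"
  have p0: "poly p 0 = c" by (simp add: c_def poly_0_coeff_0)
  have "poly p (- 1) = poly (pcompose p [:- 1, - 1:]) 0" by (simp add: poly_pcompose)
  then have p1: "poly p (- 1) = c" using Suc.prems(1) p0 by simp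
  have "poly (p - [:c:]) 0 = 0" using p0 by simp
  then have "[:0, 1:] dvd p - [:c:]" using poly_eq_0_iff_dvd[of "p - [:c:]" 0] by simp
  then obtain r where r: "p - [:c:] = [:0, 1:] * r" by blast
  have "poly (p - [:c:]) (- 1) = - poly r (- 1)" unfolding r by simp
  then have "poly r (- 1) = 0" using p1 by simp
  then have "[:1, 1:] dvd r" using poly_eq_0_iff_dvd[of r "- 1"] by simp
  then obtain q where q: "r = [:1, 1:] * q" by blast
  have "p - [:c:] = ([:0, 1:] * [:1, 1:]) * q" unfolding r q by (simp only: mult.assoc)
  then have pq: "p = [:c:] + [:0, 1, 1:] * q" by (simp add: algebra_simps)
  have sym: "pcompose q [:- 1, - 1:] = q"
  proof -
    have "pcompose [:0, 1, 1:] [:- 1, - 1:] = [:0, 1, 1 :: real:]"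
      by (simp add: pcompose_pCons)
    then have "pcompose p [:- 1, - 1:] = [:c:] + [:0, 1, 1:] * pcompose q [:- 1, - 1:]"
      unfolding pq by (simp only: pcompose_add pcompose_mult pcompose_const)
    then have "[:0, 1, 1:] * pcompose q [:- 1, - 1:] = [:0, 1, 1:] * q"
      using Suc.prems(1) pq by (metis add_left_cancel)
    then show ?thesis by (subst (asm) mult_cancel_left) auto
  qed
  have deg: "degree q \<le> 2 * n"
  proof (cases "q = 0")
    case False
    have "degree ([:0, 1, 1:] * q) = 2 + degree q"
      using False by (subst degree_mult_eq) auto
    moreover have "degree ([:0, 1, 1:] * q) \<le> 2 * Suc n"
    proof -
      have "[:0, 1, 1:] * q = p - [:c:]" using pq by simp
      then show ?thesis using Suc.prems(2) by (simp only:) (rule degree_diff_le, auto)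
    qed
    ultimately show ?thesis by simp
  qed simp
  obtain a where a: "\<forall>i. coeff q i = (\<Sum>k\<le>n. a k * ds_coeff k i)"
    using Suc.IH[OF sym deg] by blast
  \<comment> \<open>The constant is the new coefficient of the zeroth power; multiplying the
    quotient by \<open>t + t^2\<close> shifts its coefficients up by one.\<close>
  define a' where "a' k = (case k of 0 \<Rightarrow> c | Suc m \<Rightarrow> a m)" for k
  have "coeff p i = (\<Sum>k\<le>Suc n. a' k * ds_coeff k i)" for i
  proof (cases i)
    case 0
    then show ?thesis
      unfolding sum.atMost_Suc_shift by (simp add: c_def a'_def ds_coeff_0 ds_coeff_Suc_0)
  next
    case (Suc j)
    have "coeff p i = coeff q j + (case j of 0 \<Rightarrow> 0 | Suc m \<Rightarrow> coeff q m)"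
      unfolding pq Suc by (simp add: coeff_pCons split: nat.split)
    also have "\<dots> = (\<Sum>k\<le>n. a k * ds_coeff (Suc k) (Suc j))"
      by (cases j) (simp_all add: a ds_coeff_Suc_Suc distrib_left sum.distrib)
    also have "\<dots> = (\<Sum>k\<le>Suc n. a' k * ds_coeff k i)"
      unfolding sum.atMost_Suc_shift by (simp add: Suc a'_def ds_coeff_0)
    finally show ?thesis .
  qed
  then show ?case by blast
qed

lemma f_pos_ds_coeff:
  fixes P :: "'a::euclidean_space set"
  assumes "simplicial_polytope (2 * n) P"
  shows "\<exists>a. \<forall>i\<le>2 * n. real (f_pos P (Suc i)) = (\<Sum>k\<le>n. a k * ds_coeff k i)"
proof (cases "n = 0")
  case True
  then show ?thesis by (intro exI[of _ "\<lambda>_. real (f_pos P (Suc 0))"]) (simp add: ds_coeff_0)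
next
  case False
  define p where "p = (\<Sum>i\<le>2 * n. monom (real (f_pos P (Suc i))) i)"
  have coeff: "coeff p i = (if i \<le> 2 * n then real (f_pos P (Suc i)) else 0)" for i
    by (simp add: p_def coeff_sum)
  have poly: "poly p t = (\<Sum>i\<le>2 * n. real (f_pos P (Suc i)) * t ^ i)" for t
    by (simp add: p_def poly_sum poly_monom)
  have "poly (pcompose p [:- 1, - 1:]) t = poly p t" for t
    using dehn_sommerville[OF assms, of t] False by (simp add: poly_pcompose poly)
  then have "pcompose p [:- 1, - 1:] = p" by (simp add: poly_eq_poly_eq_iff[symmetric] fun_eq_iff)
  moreover have "degree p \<le> 2 * n" by (rule degree_le) (simp add: coeff)
  ultimately obtain a where a: "\<forall>i. coeff p i = (\<Sum>k\<le>n. a k * ds_coeff k i)"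
    using symmetric_poly_coeff by blast
  have "real (f_pos P (Suc i)) = (\<Sum>k\<le>n. a k * ds_coeff k i)" if "i \<le> 2 * n" for i
    using a[rule_format, of i] coeff[of i] that by simp
  then show ?thesis by blast
qed

text \<open>The sum is a polynomial in \<open>N\<close> with infinitely many roots, so the relation
  extends to small \<open>N\<close>, where the binomials are triangular: at \<open>N = m\<close> the
  terms above \<open>m\<close> vanish, and those below vanish by induction.\<close>

lemma binomial_poly_relation:
  fixes \<beta> :: "nat \<Rightarrow> real"
  assumes "\<And>N. M < N \<Longrightarrow> (\<Sum>i\<le>n. \<beta> i * real (N choose i)) = 0" and "i \<le> n"
  shows "\<beta> i = 0"
proof -
  define p where "p = (\<Sum>i\<le>n. Polynomial.smult (\<beta> i / fact i) (\<Prod>j<i. [:- real j, 1:]))"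
  have poly: "poly p (real N) = (\<Sum>i\<le>n. \<beta> i * real (N choose i))" for N
    by (simp add: p_def poly_sum poly_prod binomial_gbinomial gbinomial_prod_rev atLeast0LessThan)
  have "real ` {M<..} \<subseteq> {x. poly p x = 0}" using assms(1) poly by auto
  moreover have "infinite (real ` {M<..})"
    by (simp add: finite_image_iff inj_on_def infinite_Ioi)
  ultimately have "p = 0" using poly_roots_finite finite_subset by blast
  then have zero: "(\<Sum>i\<le>n. \<beta> i * real (N choose i)) = 0" for N using poly[of N] by simp
  show ?thesis using \<open>i \<le> n\<close>
  proof (induction i rule: less_induct)
    case (less m)
    have "(\<Sum>i\<le>n. \<beta> i * real (m choose i)) = (\<Sum>i\<in>{m}. \<beta> i * real (m choose i))"
    proof (rule sum.mono_neutral_right)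
      show "\<forall>i\<in>{..n} - {m}. \<beta> i * real (m choose i) = 0"
        using less by (metis DiffE atMost_iff binomial_eq_0 insertI1 linorder_neqE_nat mult_eq_0_iff of_nat_0)
    qed (use less.prems in auto)
    then show ?case using zero[of m] by simp
  qed
qed

text \<open>Exponents \<open>i\<close> count from \<open>0\<close>; they correspond to the positions \<open>Suc i\<close>
  of the \<open>f\<close>-vector.\<close>

definition ballot :: "nat \<Rightarrow> nat set \<Rightarrow> bool" where
  "ballot n E \<longleftrightarrow> card E = Suc n \<and> (\<forall>k\<le>n. k < card (E \<inter> {..2 * k}))"

text \<open>If \<open>e k\<close> exceeded \<open>2 * k\<close>, only the \<open>k\<close> smaller
  values \<open>e 0\<close>, ..., \<open>e (k - 1)\<close> could lie in
  \<open>{..2 * k}\<close>.\<close>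

lemma ballot_enumerate:
  assumes "ballot n E"
  obtains e where "bij_betw e {..n} E" "\<And>j k. j < k \<Longrightarrow> k \<le> n \<Longrightarrow> e j < e k"
    "\<And>k. k \<le> n \<Longrightarrow> e k \<le> (2 * k :: nat)"
proof -
  have card: "card E = Suc n" using assms by (simp add: ballot_def)
  then have fin: "finite E" using card.infinite by fastforce
  define e where "e k = sorted_list_of_set E ! k" for k
  have len: "length (sorted_list_of_set E) = Suc n" by (simp add: card)
  have bij: "bij_betw e {..n} E"
    unfolding e_def by (rule bij_betw_nth) (use fin len in auto)
  have strict: "e j < e k" if "j < k" "k \<le> n" for j k
    unfolding e_def by (rule sorted_wrt_nth_less[of "(<)"]) (use that len in auto)
  have "e k \<le> 2 * k" if k: "k \<le> n" for k
  proof (rule ccontr)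
    assume gt: "\<not> e k \<le> 2 * k"
    have "E \<inter> {..2 * k} \<subseteq> e ` {..<k}"
    proof
      fix i assume i: "i \<in> E \<inter> {..2 * k}"
      then obtain j where j: "j \<le> n" "i = e j" using bij by (auto simp: bij_betw_def)
      have "\<not> k \<le> j"
      proof
        assume "k \<le> j"
        then have "e k \<le> e j" using strict[of k j] j by (cases "k = j") auto
        then show False using gt i j by simp
      qed
      then show "i \<in> e ` {..<k}" using j by simp
    qed
    then have "card (E \<inter> {..2 * k}) \<le> card (e ` {..<k})" by (intro card_mono) auto
    also have "\<dots> \<le> k" using card_image_le[of "{..<k}" e] by simp
    finally show False using assms k by (auto simp: ballot_def)
  qed
  with bij strict show ?thesis using that by blast
qed

section \<open>Columns, and linear relations among f-vectors\<close>

text \<open>Sums run over indices, not vectors, so that members of the family may coincide.\<close>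

lemma span_image_finite:
  fixes f :: "'i \<Rightarrow> 'a::real_vector"
  assumes "finite E"
  shows "span (f ` E) = range (\<lambda>c. \<Sum>i\<in>E. c i *\<^sub>R f i)"
proof
  show "span (f ` E) \<subseteq> range (\<lambda>c. \<Sum>i\<in>E. c i *\<^sub>R f i)"
  proof (rule span_minimal)
    show "f ` E \<subseteq> range (\<lambda>c. \<Sum>i\<in>E. c i *\<^sub>R f i)"
    proof
      fix y assume "y \<in> f ` E"
      then obtain j where j: "j \<in> E" "y = f j" by blast
      have "(\<Sum>i\<in>E. (if i = j then 1 else 0) *\<^sub>R f i) = (\<Sum>i\<in>E. if i = j then f j else 0)"
        by (intro sum.cong) auto
      also have "\<dots> = y" using j assms by simp
      finally have y: "(\<Sum>i\<in>E. (if i = j then 1 else 0) *\<^sub>R f i) = y" .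
      show "y \<in> range (\<lambda>c. \<Sum>i\<in>E. c i *\<^sub>R f i)"
        by (rule range_eqI[of _ _ "\<lambda>i. if i = j then 1 else 0"]) (rule y[symmetric])
    qed
    show "subspace (range (\<lambda>c. \<Sum>i\<in>E. c i *\<^sub>R f i))"
      unfolding subspace_def
    proof (intro conjI ballI allI)
      show "0 \<in> range (\<lambda>c. \<Sum>i\<in>E. c i *\<^sub>R f i)"
        by (rule range_eqI[of _ _ "\<lambda>_. 0"]) simp
    next
      fix x y assume "x \<in> range (\<lambda>c. \<Sum>i\<in>E. c i *\<^sub>R f i)" "y \<in> range (\<lambda>c. \<Sum>i\<in>E. c i *\<^sub>R f i)"
      then obtain c c' where "x = (\<Sum>i\<in>E. c i *\<^sub>R f i)" "y = (\<Sum>i\<in>E. c' i *\<^sub>R f i)" by blast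
      then show "x + y \<in> range (\<lambda>c. \<Sum>i\<in>E. c i *\<^sub>R f i)"
        by (intro range_eqI[of _ _ "\<lambda>i. c i + c' i"]) (simp add: scaleR_add_left sum.distrib)
    next
      fix r x assume "x \<in> range (\<lambda>c. \<Sum>i\<in>E. c i *\<^sub>R f i)"
      then obtain c where "x = (\<Sum>i\<in>E. c i *\<^sub>R f i)" by blast
      then show "r *\<^sub>R x \<in> range (\<lambda>c. \<Sum>i\<in>E. c i *\<^sub>R f i)"
        by (intro range_eqI[of _ _ "\<lambda>i. r * c i"]) (simp add: scaleR_sum_right)
    qed
  qed
  show "range (\<lambda>c. \<Sum>i\<in>E. c i *\<^sub>R f i) \<subseteq> span (f ` E)"
    by (auto intro!: span_sum span_scale intro: span_base)
qed

text \<open>A repeated vector would give a relation with coefficients \<open>1\<close> and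
  \<open>- 1\<close>, so independence of the indexed family includes injectivity.\<close>

lemma family_independent:
  fixes f :: "'i \<Rightarrow> 'a::real_vector"
  assumes "finite E" and zero: "\<And>c i. (\<Sum>i\<in>E. c i *\<^sub>R f i) = 0 \<Longrightarrow> i \<in> E \<Longrightarrow> c i = 0"
  shows "inj_on f E" "independent (f ` E)"
proof -
  show inj: "inj_on f E"
  proof (rule inj_onI, rule ccontr)
    fix i j assume ij: "i \<in> E" "j \<in> E" "f i = f j" "i \<noteq> j"
    define c :: "'i \<Rightarrow> real" where "c k = (if k = i then 1 else 0) - (if k = j then 1 else 0)" for k
    have "(\<Sum>k\<in>E. c k *\<^sub>R f k) = (\<Sum>k\<in>E. if k = i then f i else 0) - (\<Sum>k\<in>E. if k = j then f j else 0)"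
      unfolding sum_subtractf[symmetric] by (intro sum.cong) (auto simp: c_def)
    also have "\<dots> = 0" using ij assms(1) by simp
    finally have "c i = 0" using zero ij(1) by blast
    then show False using ij(4) by (simp add: c_def)
  qed
  show "independent (f ` E)"
  proof (rule independent_if_scalars_zero)
    show "finite (f ` E)" using assms(1) by simp
    fix g y assume g: "(\<Sum>x\<in>f ` E. g x *\<^sub>R x) = 0" and "y \<in> f ` E"
    then obtain i where i: "i \<in> E" "y = f i" by blast
    have "(\<Sum>i\<in>E. g (f i) *\<^sub>R f i) = 0" using g by (simp add: sum.reindex[OF inj])
    then show "g y = 0" using zero[of "\<lambda>i. g (f i)" i] i by simp
  qed
qed

text \<open>The columns of the coefficient matrix are realized as vectors of the ambient space of the
  polytopes, which has dimension at least \<open>n + 1\<close>.\<close>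

locale ds_columns =
  fixes n :: nat and b :: "nat \<Rightarrow> 'a::euclidean_space"
  assumes b_Basis: "b ` {..n} \<subseteq> Basis" and b_inj: "inj_on b {..n}"
begin

definition column :: "nat \<Rightarrow> 'a" where
  "column i = (\<Sum>k\<le>n. ds_coeff k i *\<^sub>R b k)"

definition W :: "'a set" where "W = span (b ` {..n})"

lemma inner_b: "j \<le> n \<Longrightarrow> k \<le> n \<Longrightarrow> b j \<bullet> b k = (if j = k then 1 else 0)"
  using b_Basis b_inj by (subst inner_Basis) (auto simp: inj_on_eq_iff)

lemma independent_b: "A \<subseteq> {..n} \<Longrightarrow> independent (b ` A)"
  using b_Basis by (intro independent_mono[OF independent_Basis]) auto

lemma dim_b: "A \<subseteq> {..n} \<Longrightarrow> dim (span (b ` A)) = card A"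
  using independent_b dim_span_eq_card_independent card_image[OF inj_on_subset[OF b_inj]] by metis

lemma dim_W: "dim W = Suc n"
  using dim_b[of "{..n}"] by (simp add: W_def)

lemma column_in_W: "column i \<in> W"
  unfolding column_def W_def by (intro span_sum span_scale span_base) auto

lemma inner_column:
  assumes "k \<le> n"
  shows "column i \<bullet> b k = ds_coeff k i"
proof -
  have "column i \<bullet> b k = (\<Sum>j\<le>n. ds_coeff j i * (b j \<bullet> b k))"
    by (simp add: column_def inner_sum_left)
  also have "\<dots> = (\<Sum>j\<le>n. if j = k then ds_coeff k i else 0)"
    by (intro sum.cong refl) (use assms in \<open>auto simp: inner_b\<close>)
  also have "\<dots> = ds_coeff k i" using assms by simp
  finally show ?thesis .
qed

lemma sum_columns:
  "(\<Sum>i\<in>E. c i *\<^sub>R column i) = (\<Sum>k\<le>n. (\<Sum>i\<in>E. c i * ds_coeff k i) *\<^sub>R b k)"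
proof -
  have "(\<Sum>i\<in>E. c i *\<^sub>R column i) = (\<Sum>i\<in>E. \<Sum>k\<le>n. (c i * ds_coeff k i) *\<^sub>R b k)"
    by (simp add: column_def scaleR_sum_right)
  also have "\<dots> = (\<Sum>k\<le>n. \<Sum>i\<in>E. (c i * ds_coeff k i) *\<^sub>R b k)"
    by (rule sum.swap)
  finally show ?thesis by (simp add: scaleR_sum_left)
qed

lemma ballot_columns_independent:
  assumes "ballot n E"
  shows "inj_on column E" "independent (column ` E)"
proof -
  have fin: "finite E" using assms card.infinite by (fastforce simp: ballot_def)
  obtain e where e: "bij_betw e {..n} E" "\<And>j k. j < k \<Longrightarrow> k \<le> n \<Longrightarrow> e j < e k"
      "\<And>k. k \<le> n \<Longrightarrow> e k \<le> 2 * k"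
    using ballot_enumerate[OF assms] by blast
  have zero: "c i = 0" if c: "(\<Sum>i\<in>E. c i *\<^sub>R column i) = 0" and i: "i \<in> E" for c i
  proof -
    have "(\<Sum>j\<le>n. c (e j) * ds_coeff k (e j)) = 0" if k: "k \<le> n" for k
    proof -
      have "(\<Sum>j\<le>n. c (e j) * ds_coeff k (e j)) = (\<Sum>i\<in>E. c i * ds_coeff k i)"
        by (rule sum.reindex_bij_betw[OF e(1)])
      also have "\<dots> = (\<Sum>i\<in>E. c i *\<^sub>R column i) \<bullet> b k"
        by (simp add: inner_sum_left inner_column[OF k])
      finally show ?thesis using c by simp
    qed
    then have "c (e j) = 0" if "j \<le> n" for j
      using ds_coeff_columns_independent[of n e "\<lambda>j. c (e j)" j] e(2,3) that by blast
    then show ?thesis using e(1) i by (auto simp: bij_betw_def)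
  qed
  show "inj_on column E" by (rule family_independent(1)[OF fin]) (rule zero)
  show "independent (column ` E)" by (rule family_independent(2)[OF fin]) (rule zero)
qed

lemma ballot_columns_span:
  assumes "ballot n E"
  shows "W \<subseteq> span (column ` E)"
proof (rule card_ge_dim_independent)
  show "column ` E \<subseteq> W" using column_in_W by blast
  show "independent (column ` E)" by (rule ballot_columns_independent[OF assms])
  show "dim W \<le> card (column ` E)"
    using card_image[OF ballot_columns_independent(1)[OF assms]] assms by (simp add: dim_W ballot_def)
qed

text \<open>Makes the first \<open>n + 1\<close> columns a reference basis; they belong to the
  entries that are known explicitly for cyclic polytopes.\<close>

lemma ballot_atMost: "ballot n {..n}"
proof -
  have "card ({..n} \<inter> {..2 * k}) > k" if "k \<le> n" for k
  proof -
    have "{..n} \<inter> {..2 * k} = {..min n (2 * k)}" by auto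
    then show ?thesis using that by simp
  qed
  then show ?thesis by (simp add: ballot_def)
qed

text \<open>Rewriting the columns in the reference basis reduces the relation to one among exponents
  at most \<open>n\<close>. On cyclic polytopes this is a vanishing combination of binomials
  \<open>N choose i\<close> for all large \<open>N\<close>, so its coefficients are zero.\<close>

lemma relation_on_rows:
  assumes DIM: "2 * n \<le> DIM('a)"
    and \<beta>: "\<And>P :: 'a set. simplicial_polytope (2 * n) P \<Longrightarrow> (\<Sum>i\<le>2 * n. \<beta> i * real (f_pos P (Suc i))) = 0"
    and k: "k \<le> n"
  shows "(\<Sum>i\<le>2 * n. \<beta> i * ds_coeff k i) = 0"
proof -
  have "(\<Sum>i\<le>2 * n. \<beta> i *\<^sub>R column i) \<in> W"
    unfolding W_def by (intro span_sum span_scale) (use column_in_W in \<open>simp add: W_def\<close>)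
  then obtain c where c: "(\<Sum>i\<le>2 * n. \<beta> i *\<^sub>R column i) = (\<Sum>i\<le>n. c i *\<^sub>R column i)"
    using ballot_columns_span[OF ballot_atMost] span_image_finite[of "{..n}" column] by auto
  have rows: "(\<Sum>i\<le>2 * n. \<beta> i * ds_coeff k i) = (\<Sum>i\<le>n. c i * ds_coeff k i)" if "k \<le> n" for k
    using arg_cong[OF c, of "\<lambda>v. v \<bullet> b k"] that by (simp add: inner_sum_left inner_column)
  have "c i = 0" if "i \<le> n" for i
  proof (rule binomial_poly_relation[where M = "2 * n" and \<beta> = c, OF _ that])
    fix N assume N: "2 * n < N"
    obtain P :: "'a set" where P: "simplicial_polytope (2 * n) P" "\<forall>i\<le>n. f_pos P (Suc i) = N choose i"
      using exists_neighborly_polytope[OF DIM N] by blast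
    obtain a where a: "\<forall>i\<le>2 * n. real (f_pos P (Suc i)) = (\<Sum>k\<le>n. a k * ds_coeff k i)"
      using f_pos_ds_coeff[OF P(1)] by blast
    \<comment> \<open>Applied to \<open>c\<close> with \<open>m = n\<close> and to
      \<open>\<beta>\<close> with \<open>m = 2 * n\<close>. Both pair equally with every row, hence
      also with the f-vector, a combination of rows.\<close>
    have swap: "(\<Sum>i\<le>m. \<gamma> i * real (f_pos P (Suc i))) = (\<Sum>k\<le>n. a k * (\<Sum>i\<le>m. \<gamma> i * ds_coeff k i))"
      if "m \<le> 2 * n" for m and \<gamma> :: "nat \<Rightarrow> real"
    proof -
      have "(\<Sum>i\<le>m. \<gamma> i * real (f_pos P (Suc i))) = (\<Sum>i\<le>m. \<Sum>k\<le>n. a k * (\<gamma> i * ds_coeff k i))"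
        using that by (intro sum.cong refl) (simp add: a sum_distrib_left mult_ac)
      also have "\<dots> = (\<Sum>k\<le>n. \<Sum>i\<le>m. a k * (\<gamma> i * ds_coeff k i))" by (rule sum.swap)
      finally show ?thesis by (simp add: sum_distrib_left)
    qed
    have "(\<Sum>i\<le>n. c i * real (N choose i)) = (\<Sum>i\<le>n. c i * real (f_pos P (Suc i)))"
      using P(2) by simp
    also have "\<dots> = (\<Sum>i\<le>2 * n. \<beta> i * real (f_pos P (Suc i)))"
      by (simp add: swap rows)
    also have "\<dots> = 0" by (rule \<beta>[OF P(1)])
    finally show "(\<Sum>i\<le>n. c i * real (N choose i)) = 0" .
  qed
  then show ?thesis using rows[OF k] by simp
qed

text \<open>A formula for an entry is a relation among f-vectors, hence among the rows, and so
  expresses one column through others. Conversely, coefficients expressing the columns also work for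
  every f-vector, since it is a combination of rows.\<close>

lemma determines_iff_span:
  assumes DIM: "2 * n \<le> DIM('a)" and E: "E \<subseteq> {..2 * n}"
  shows "determines_f_vector TYPE('a) (2 * n) (Suc ` E) \<longleftrightarrow> W \<subseteq> span (column ` E)"
proof
  assume "determines_f_vector TYPE('a) (2 * n) (Suc ` E)"
  then obtain c where c: "\<And>P :: 'a set. \<And>j. simplicial_polytope (2 * n) P \<Longrightarrow> j \<in> {1..2 * n + 1} \<Longrightarrow>
      real (f_pos P j) = (\<Sum>i\<in>Suc ` E. c j i * real (f_pos P i))"
    unfolding determines_f_vector_def by blast
  have "column j \<in> span (column ` E)" if j: "j \<le> 2 * n" for j
  proof -
    \<comment> \<open>The formula for position \<open>Suc j\<close>, brought to one side and indexed
      by exponents.\<close>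
    define \<beta> where "\<beta> i = (if i = j then 1 else 0) - (if i \<in> E then c (Suc j) (Suc i) else 0)" for i
    have sum: "(\<Sum>i\<le>2 * n. \<beta> i * g i) = g j - (\<Sum>i\<in>E. c (Suc j) (Suc i) * g i)" for g :: "nat \<Rightarrow> real"
    proof -
      have "(\<Sum>i\<le>2 * n. \<beta> i * g i) =
          (\<Sum>i\<le>2 * n. if i = j then g j else 0) - (\<Sum>i\<le>2 * n. if i \<in> E then c (Suc j) (Suc i) * g i else 0)"
        unfolding sum_subtractf[symmetric] by (intro sum.cong) (auto simp: \<beta>_def algebra_simps)
      also have "(\<Sum>i\<le>2 * n. if i \<in> E then c (Suc j) (Suc i) * g i else 0) = (\<Sum>i\<in>E. c (Suc j) (Suc i) * g i)"
        using E by (simp add: sum.If_cases Int_absorb1)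
      finally show ?thesis using j by simp
    qed
    have rel: "(\<Sum>i\<le>2 * n. \<beta> i * ds_coeff k i) = 0" if "k \<le> n" for k
    proof (rule relation_on_rows[OF DIM _ that])
      fix P :: "'a set" assume "simplicial_polytope (2 * n) P"
      then show "(\<Sum>i\<le>2 * n. \<beta> i * real (f_pos P (Suc i))) = 0"
        using c[of P "Suc j"] j by (simp add: sum sum.reindex)
    qed
    have "column j = (\<Sum>k\<le>n. (\<Sum>i\<in>E. c (Suc j) (Suc i) * ds_coeff k i) *\<^sub>R b k)"
      unfolding column_def by (intro sum.cong refl) (use rel sum in auto)
    also have "\<dots> = (\<Sum>i\<in>E. c (Suc j) (Suc i) *\<^sub>R column i)"
      by (rule sum_columns[symmetric])
    also have "\<dots> \<in> span (column ` E)" by (intro span_sum span_scale span_base) auto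
    finally show ?thesis .
  qed
  then have "span (column ` {..n}) \<subseteq> span (column ` E)"
    by (intro span_minimal) auto
  then show "W \<subseteq> span (column ` E)" using ballot_columns_span[OF ballot_atMost] by blast
next
  have fin: "finite E" using E finite_subset by blast
  assume W: "W \<subseteq> span (column ` E)"
  have "\<exists>c. column j = (\<Sum>i\<in>E. c i *\<^sub>R column i)" for j
    using W column_in_W[of j] span_image_finite[OF fin, of column] by auto
  then obtain c where c: "\<And>j. column j = (\<Sum>i\<in>E. c j i *\<^sub>R column i)" by metis
  have rows: "ds_coeff k j = (\<Sum>i\<in>E. c j i * ds_coeff k i)" if "k \<le> n" for k j
    using arg_cong[OF c[of j], of "\<lambda>v. v \<bullet> b k"] that by (simp add: inner_sum_left inner_column)
  show "determines_f_vector TYPE('a) (2 * n) (Suc ` E)"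
    unfolding determines_f_vector_def
  proof (intro exI[of _ "\<lambda>j i. c (j - 1) (i - 1)"] allI impI ballI)
    fix P :: "'a set" and j assume P: "simplicial_polytope (2 * n) P" and "j \<in> {1..2 * n + 1}"
    then obtain m where m: "j = Suc m" "m \<le> 2 * n" by (cases j) auto
    obtain a where a: "\<forall>i\<le>2 * n. real (f_pos P (Suc i)) = (\<Sum>k\<le>n. a k * ds_coeff k i)"
      using f_pos_ds_coeff[OF P] by blast
    have "real (f_pos P j) = (\<Sum>k\<le>n. a k * (\<Sum>i\<in>E. c m i * ds_coeff k i))"
      using a m rows by simp
    also have "\<dots> = (\<Sum>k\<le>n. \<Sum>i\<in>E. c m i * (a k * ds_coeff k i))"
      by (simp add: sum_distrib_left mult_ac)
    also have "\<dots> = (\<Sum>i\<in>E. \<Sum>k\<le>n. c m i * (a k * ds_coeff k i))" by (rule sum.swap)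
    also have "\<dots> = (\<Sum>i\<in>E. c m i * real (f_pos P (Suc i)))"
      using E a by (intro sum.cong refl) (auto simp: sum_distrib_left)
    also have "\<dots> = (\<Sum>i\<in>Suc ` E. c (j - 1) (i - 1) * real (f_pos P i))"
      by (simp add: sum.reindex m)
    finally show "real (f_pos P j) = (\<Sum>i\<in>Suc ` E. c (j - 1) (i - 1) * real (f_pos P i))" .
  qed
qed

text \<open>A minimal spanning family is a basis and has \<open>n + 1\<close> members. Those with
  exponent above \<open>2 * k\<close> lie in the span of the last \<open>n - k\<close> unit vectors,
  which leaves at least \<open>k + 1\<close> members up to \<open>2 * k\<close>. In the converse
  direction, a proper subset is too small to span.\<close>

lemma minimal_span_iff_ballot:
  assumes E: "E \<subseteq> {..2 * n}"
  shows "W \<subseteq> span (column ` E) \<and> (\<forall>E'. E' \<subset> E \<longrightarrow> \<not> W \<subseteq> span (column ` E')) \<longleftrightarrow> ballot n E"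
proof
  have fin: "finite E" using E finite_subset by blast
  assume min: "W \<subseteq> span (column ` E) \<and> (\<forall>E'. E' \<subset> E \<longrightarrow> \<not> W \<subseteq> span (column ` E'))"
  obtain B where B: "B \<subseteq> column ` E" "independent B" "column ` E \<subseteq> span B"
    using maximal_independent_subset[of "column ` E"] by blast
  \<comment> \<open>Choosing one index for each basis vector makes minimality rule out both
    dependent and repeated columns.\<close>
  obtain E' where E': "E' \<subseteq> E" "inj_on column E'" "B = column ` E'"
    using B(1) subset_image_inj by metis
  have "span (column ` E) \<subseteq> span B" using B(3) by (intro span_minimal) auto
  then have "E' = E" using min E' by blast
  then have inj: "inj_on column E" and indep: "independent (column ` E)" using E' B(2) by auto
  have "span (column ` E) = W"
    using min column_in_W by (intro equalityI span_minimal) (auto simp: W_def)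
  then have card: "card E = Suc n"
    using dim_span_eq_card_independent[OF indep] card_image[OF inj] dim_W by simp
  have "k < card (E \<inter> {..2 * k})" if k: "k \<le> n" for k
  proof -
    define H where "H = E - {..2 * k}"
    have "column i \<in> span (b ` {Suc k..n})" if i: "i \<in> H" for i
    proof -
      have "column i = (\<Sum>j\<in>{Suc k..n}. ds_coeff j i *\<^sub>R b j)"
        unfolding column_def
        by (rule sum.mono_neutral_right) (use i in \<open>auto simp: H_def not_le intro!: ds_coeff_eq_0\<close>)
      then show ?thesis by (simp only:) (intro span_sum span_scale span_base, auto)
    qed
    then have "column ` H \<subseteq> span (b ` {Suc k..n})" by blast
    moreover have "independent (column ` H)"
      by (rule independent_mono[OF indep]) (auto simp: H_def)
    ultimately have "card (column ` H) \<le> dim (span (b ` {Suc k..n}))"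
      using independent_card_le_dim by blast
    also have "\<dots> = n - k" by (subst dim_b) auto
    also have "card (column ` H) = card H"
      by (rule card_image[OF inj_on_subset[OF inj]]) (auto simp: H_def)
    finally have "card H \<le> n - k" .
    moreover have "card E = card (E \<inter> {..2 * k}) + card H"
      using fin unfolding H_def by (rule card_Int_Diff)
    ultimately show ?thesis using card k by simp
  qed
  then show "ballot n E" using card by (simp add: ballot_def)
next
  have fin: "finite E" using E finite_subset by blast
  assume ballot: "ballot n E"
  have "\<not> W \<subseteq> span (column ` E')" if "E' \<subset> E" for E'
  proof
    assume "W \<subseteq> span (column ` E')"
    moreover have finE': "finite E'" using that fin finite_subset by blast
    ultimately have "dim W \<le> card (column ` E')" by (intro dim_le_card) auto
    also have "\<dots> \<le> card E'" by (rule card_image_le[OF finE'])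
    also have "\<dots> < card E" by (rule psubset_card_mono[OF fin that])
    finally show False using ballot by (simp add: dim_W ballot_def)
  qed
  then show "W \<subseteq> span (column ` E) \<and> (\<forall>E'. E' \<subset> E \<longrightarrow> \<not> W \<subseteq> span (column ` E'))"
    using ballot_columns_span[OF ballot] by blast
qed

end

section \<open>Dyck paths and ballot sets\<close>

lemma sum_list_take_eq_card:
  fixes w :: "int list"
  assumes "set w \<subseteq> {1, - 1}" "k \<le> length w"
  shows "sum_list (take k w) = 2 * int (card {i. i < k \<and> w ! i = 1}) - int k"
  using assms(2)
proof (induction k)
  case (Suc k)
  have "{i. i < Suc k \<and> w ! i = 1} = (if w ! k = 1 then insert k {i. i < k \<and> w ! i = 1} else {i. i < k \<and> w ! i = 1})"
    by (auto simp: less_Suc_eq)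
  moreover have "w ! k \<in> {1, - 1}" using assms(1) Suc.prems by (meson Suc_le_lessD nth_mem subsetD)
  ultimately show ?case using Suc by (auto simp: take_Suc_conv_app_nth)
qed simp

lemma upsteps_eq: "upsteps w = Suc ` {i. i < length w \<and> w ! i = 1}"
proof (intro equalityI subsetI)
  fix i assume "i \<in> upsteps w"
  then show "i \<in> Suc ` {i. i < length w \<and> w ! i = 1}"
    by (cases i) (auto simp: upsteps_def)
qed (auto simp: upsteps_def)

text \<open>After \<open>2 * k + 1\<close> steps, which are the indices \<open>0\<close> to
  \<open>2 * k\<close>, the height is odd, so being nonnegative means at least \<open>k + 1\<close>
  upsteps. The next step lowers the height by at most one, so prefixes of even length need no
  condition of their own.\<close>

lemma upsteps_dyck_iff_ballot:
  assumes E: "E \<subseteq> {..2 * n}"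
  shows "(\<exists>w. dyck_path (n + 1) w \<and> Suc ` E = upsteps w) \<longleftrightarrow> ballot n E"
proof
  assume "\<exists>w. dyck_path (n + 1) w \<and> Suc ` E = upsteps w"
  then obtain w where w: "length w = 2 * n + 2" "set w \<subseteq> {1, - 1}" "sum_list w = 0"
      "\<And>k. k \<le> 2 * n + 2 \<Longrightarrow> 0 \<le> sum_list (take k w)" and "Suc ` E = upsteps w"
    by (auto simp: dyck_path_def)
  then have Ew: "E = {i. i < length w \<and> w ! i = 1}"
    unfolding upsteps_eq by (simp add: inj_image_eq_iff)
  have "sum_list (take (length w) w) = 2 * int (card E) - int (length w)"
    unfolding Ew by (rule sum_list_take_eq_card[OF w(2)]) simp
  then have "card E = Suc n" using w(1,3) by simp
  moreover have "k < card (E \<inter> {..2 * k})" if "k \<le> n" for k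
  proof -
    have "E \<inter> {..2 * k} = {i. i < Suc (2 * k) \<and> w ! i = 1}"
      unfolding Ew using w(1) that by (auto simp: less_Suc_eq_le)
    then have "sum_list (take (Suc (2 * k)) w) = 2 * int (card (E \<inter> {..2 * k})) - int (Suc (2 * k))"
      using sum_list_take_eq_card[OF w(2), of "Suc (2 * k)"] w(1) that by simp
    then show ?thesis using w(4)[of "Suc (2 * k)"] that by simp
  qed
  ultimately show "ballot n E" by (simp add: ballot_def)
next
  assume ballot: "ballot n E"
  define w :: "int list" where "w = map (\<lambda>i. if i \<in> E then 1 else - 1) [0..<2 * n + 2]"
  have len: "length w = 2 * n + 2" by (simp add: w_def)
  have set: "set w \<subseteq> {1, - 1}" by (auto simp: w_def)
  have nth: "w ! i = 1 \<longleftrightarrow> i \<in> E" if "i < 2 * n + 2" for i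
    using that by (simp add: w_def del: upt_Suc)
  have take: "sum_list (take k w) = 2 * int (card (E \<inter> {..<k})) - int k" if "k \<le> 2 * n + 2" for k
  proof -
    have "{i. i < k \<and> w ! i = 1} = E \<inter> {..<k}" using nth that by auto
    then show ?thesis using sum_list_take_eq_card[OF set, of k] len that by simp
  qed
  have nonneg: "0 \<le> sum_list (take k w)" if k: "k \<le> 2 * n + 2" for k
  proof (cases "k = 0")
    case False
    \<comment> \<open>Chosen so that \<open>k\<close> is \<open>2 * j + 1\<close> or
      \<open>2 * j + 2\<close>; the \<open>j + 1\<close> upsteps among the first
      \<open>2 * j + 1\<close> steps suffice in both cases.\<close>
    define j where "j = (k - 1) div 2"
    have j: "j \<le> n" "2 * j < k" "k \<le> 2 * j + 2" using False k by (auto simp: j_def)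
    have "j < card (E \<inter> {..2 * j})" using ballot j(1) by (simp add: ballot_def)
    also have "\<dots> \<le> card (E \<inter> {..<k})" by (rule card_mono) (use j(2) in auto)
    finally show ?thesis using take[OF k] j(3) by simp
  qed simp
  have "E \<inter> {..<2 * n + 2} = E" using E by auto
  then have "sum_list w = 0"
    using take[of "2 * n + 2"] ballot len by (simp add: ballot_def)
  moreover have "Suc ` E = upsteps w"
    unfolding upsteps_eq len using nth E by (intro arg_cong[where f = "(`) Suc"]) auto
  ultimately show "\<exists>w. dyck_path (n + 1) w \<and> Suc ` E = upsteps w"
    using len set nonneg by (intro exI[of _ w]) (simp add: dyck_path_def)
qed

theorem theorem1p1:
  fixes n :: nat and S :: "nat set"
  assumes "2 * n \<le> DIM('a::euclidean_space)"
    and "S \<subseteq> {1..2 * n + 1}"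
  shows "dehn_sommerville_basis TYPE('a) (2 * n) S \<longleftrightarrow>
         (\<exists>w. dyck_path (n + 1) w \<and> S = upsteps w)"
proof -
  define E where "E = {i. Suc i \<in> S}"
  have S: "S = Suc ` E"
  proof (intro equalityI subsetI)
    fix i assume "i \<in> S"
    then show "i \<in> Suc ` E" using assms(2) by (cases i) (auto simp: E_def)
  qed (auto simp: E_def)
  have E: "E \<subseteq> {..2 * n}" using assms(2) by (auto simp: E_def)
  \<comment> \<open>Room for column vectors with \<open>n + 1\<close> coordinates:
    \<open>2 * n\<close> suffices when \<open>n\<close> is positive, and for \<open>n = 0\<close>
    every Euclidean space has dimension at least \<open>1\<close>.\<close>
  have "Suc n \<le> DIM('a)" using assms(1) DIM_positive[where 'a = 'a] by (cases n) auto
  then obtain B where B: "B \<subseteq> (Basis :: 'a set)" "card B = Suc n"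
    by (rule obtain_subset_with_card_n)
  have "finite B" using B(1) finite_Basis finite_subset by blast
  then obtain b where b: "bij_betw b {..n} B"
    using ex_bij_betw_nat_finite[of B] B(2) by (auto simp: atLeast0LessThan lessThan_Suc_atMost)
  interpret ds_columns n b
    using b B by unfold_locales (auto simp: bij_betw_def)
  have determines: "determines_f_vector TYPE('a) (2 * n) (Suc ` E') \<longleftrightarrow> W \<subseteq> span (column ` E')"
    if "E' \<subseteq> E" for E'
    using determines_iff_span[OF assms(1)] that E by blast
  have "(\<forall>S'. S' \<subset> S \<longrightarrow> \<not> determines_f_vector TYPE('a) (2 * n) S') \<longleftrightarrow>
      (\<forall>E'. E' \<subset> E \<longrightarrow> \<not> W \<subseteq> span (column ` E'))"
  proof (intro iffI allI impI)
    fix E' assume min: "\<forall>S'. S' \<subset> S \<longrightarrow> \<not> determines_f_vector TYPE('a) (2 * n) S'" and E': "E' \<subset> E"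
    have "Suc ` E' \<subset> S" unfolding S using E' by (simp add: image_strict_mono)
    then show "\<not> W \<subseteq> span (column ` E')" using min determines E' by blast
  next
    fix S' assume min: "\<forall>E'. E' \<subset> E \<longrightarrow> \<not> W \<subseteq> span (column ` E')" and "S' \<subset> S"
    then obtain E' where E': "E' \<subset> E" "S' = Suc ` E'"
      unfolding S by (metis image_strict_mono psubset_eq subset_image_iff)
    then show "\<not> determines_f_vector TYPE('a) (2 * n) S'" using min determines by blast
  qed
  then have "dehn_sommerville_basis TYPE('a) (2 * n) S \<longleftrightarrow>
      W \<subseteq> span (column ` E) \<and> (\<forall>E'. E' \<subset> E \<longrightarrow> \<not> W \<subseteq> span (column ` E'))"
    using assms(2) determines[of E] by (simp add: dehn_sommerville_basis_def S)
  also have "\<dots> \<longleftrightarrow> ballot n E" by (rule minimal_span_iff_ballot[OF E])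
  also have "\<dots> \<longleftrightarrow> (\<exists>w. dyck_path (n + 1) w \<and> S = upsteps w)"
    unfolding S by (rule upsteps_dyck_iff_ballot[OF E, symmetric])
  finally show ?thesis .
qed

end
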